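(* Let $\hat f_{NN}$ be the multi-source weighted $K$-NN classifier defined in the context. There exists a constant $C>0$ not depending on $n_{P_1},\dots,n_{P_m}$ or $n_Q$ such that $$\sup_{(P_1,\dots,P_m,Q)\in\Pi}\mathbb{E}\,\mathcal{E}_Q(\hat f_{NN})\le C\left(n_Q+\sum_{i=1}^m n_{P_i}^{\frac{2\beta+d}{2\gamma_i\beta+d}}\right)^{-\frac{\beta(1+\alpha)}{2\beta+d}} .$$
   Context: **Data.** $d,m\ge1$; $P_1,\dots,P_m,Q$ are probability distributions of a pair $(X,Y)$ on $[0,1]^d\times\{0,1\}$, with $X$-marginals $P_{i,X},Q_X$. One observes $n_{P_i}$ i.i.d. pairs $(X_j^{P_i},Y_j^{P_i})\sim P_i$ for each $i\in[m]=\{1,\dots,m\}$ and $n_Q$ i.i.d. pairs $(X_j^Q,Y_j^Q)\sim Q$, all independent (sample sizes are nonnegative integers, not all zero). $\mathbb{E}$ is expectation over all observed data. **Regression functions and risk.** For $G\in\{P_1,\dots,P_m,Q\}$, $\eta_G(x)=G(Y=1|X=x)$ for $x\in\mathrm{supp}(G_X)$ and $\frac12$ otherwise. The Bayes classifier is $f_Q^*(x)=0$ if $\eta_Q(x)\le\frac12$ and $1$ otherwise. For a classifier $\hat f$ (with values in $\{0,1\}$), $R_Q(\hat f)=\mathbb{P}_{(X,Y)\sim Q}(Y\ne\hat f(X))$ and $\mathcal{E}_Q(\hat f)=R_Q(\hat f)-R_Q(f_Q^* )$. **Parameter space.** Fix $\alpha\ge0$, $C_\alpha>0$, $0<\beta\le1$,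 $C_\beta>0$, $\boldsymbol\gamma=(\gamma_1,\dots,\gamma_m)$ with $\gamma_i>0$, constants $C_1,\dots,C_m>0$, $\mu=(\mu_-,\mu_+)$ with $0<\mu_-<\mu_+$, $c_\mu>0$, $r_\mu>0$, with $\alpha\beta\le d$. $\Pi=\Pi(\alpha,\beta,\boldsymbol\gamma,\mu)$ is the set of tuples $(P_1,\dots,P_m,Q)$ such that: (i) for each $i\in[m]$ and all $x\in\mathrm{supp}(P_{i,X})\cup\mathrm{supp}(Q_X)$: $(\eta_{P_i}(x)-\frac12)(\eta_Q(x)-\frac12)\ge0$ and $|\eta_{P_i}(x)-\frac12|\ge C_i|\eta_Q(x)-\frac12|^{\gamma_i}$; (ii) $Q_X(0<|\eta_Q(X)-\frac12|<t)\le C_\alpha t^\alpha$ for all $t>0$; (iii) $|\eta_Q(x_1)-\eta_Q(x_2)|\le C_\beta\|x_1-x_2\|^\beta$ for all $x_1,x_2\in\mathrm{supp}(Q_X)$ (Euclidean norm); (iv) for each $i\in[m]$: $P_{i,X},Q_X$ are absolutely continuous with respect to Lebesgue measure $\lambda$ on $\mathbb{R}^d$, $\Omega:=\mathrm{supp}(P_{i,X})=\mathrm{supp}(Q_X)$, $\lambda[\Omega\cap B(x,r)]\ge c_\mu\lambda[B(x,r)]$ for all $0<r\le r_\mu$, $x\in\Omega$, and both densities lie strictly between $\mu_-$ and $\mu_+$ at every $x\in\Omega$. **Classifier.** Let $N=n_Q+\sum_{i=1}^m n_{P_i}^{\frac{2\beta+d}{2\gamma_i\beta+d}}$, and $$w_{P_i}=N^{-\frac{\gamma_i\beta}{2\beta+d}},\quad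 w_Q=N^{-\frac{\beta}{2\beta+d}},\quad k_{P_i}=\lfloor n_{P_i}N^{-\frac{d}{2\beta+d}}\rfloor,\quad k_Q=\lfloor n_QN^{-\frac{d}{2\beta+d}}\rfloor .$$ Let $Y^{P_i}_{(j)}(x)$ (resp. $Y^Q_{(j)}(x)$) be the label of the $j$-th nearest covariate to $x$ among the $P_i$-data (resp. $Q$-data). Define $$\hat\eta_{NN}(x)=\frac{w_Q\sum_{j=1}^{k_Q}Y^Q_{(j)}(x)+\sum_{i=1}^m w_{P_i}\sum_{j=1}^{k_{P_i}}Y^{P_i}_{(j)}(x)}{w_Qk_Q+\sum_{i=1}^m w_{P_i}k_{P_i}},\qquad \hat f_{NN}(x)=\mathbb{I}\{\hat\eta_{NN}(x)>\tfrac12\},$$ with $\hat\eta_{NN}(x)=\frac12$ if all of $k_Q,k_{P_1},\dots,k_{P_m}$ are $0$. *)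

theory Defs
  imports "HOL-Probability.Probability"
begin

(* A pair (X, Y) takes values in real^'d \<times> bool, where d = CARD('d) and True encodes the
   label 1. *)

type_synonym 'd pair = "(real^'d) \<times> bool"

definition label :: "bool \<Rightarrow> real" where
  "label y = of_bool y"

abbreviation pair_space :: "('d::finite) pair measure" where
  "pair_space \<equiv> borel \<Otimes>\<^sub>M count_space UNIV"

definition pair_distribution :: "('d::finite) pair measure \<Rightarrow> bool" where
  "pair_distribution G \<longleftrightarrow>
     prob_space G \<and> sets G = sets pair_space \<and>
     (AE z in G. \<forall>i. 0 \<le> fst z $ i \<and> fst z $ i \<le> 1)"

definition marginal :: "('d::finite) pair measure \<Rightarrow> (real^'d) measure" where
  "marginal G = distr G borel fst"

definition msupp :: "'a::metric_space measure \<Rightarrow> 'a set" where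
  "msupp M = {x. \<forall>r>0. measure M (ball x r) > 0}"

(* G(Y = 1 | X = x) is determined only up to a null set of x, so a regression function of G is a
   version of this conditional probability; it is real-valued in [0,1] and equals 1/2 off the
   support of the marginal. *)
definition regression_function :: "('d::finite) pair measure \<Rightarrow> (real^'d \<Rightarrow> real) \<Rightarrow> bool" where
  "regression_function G \<eta> \<longleftrightarrow>
     \<eta> \<in> borel_measurable borel \<and>
     (AE z in G. \<eta> (fst z) =
        real_cond_exp G (vimage_algebra (space G) fst borel) (\<lambda>z. label (snd z)) z) \<and>
     (\<forall>x. 0 \<le> \<eta> x \<and> \<eta> x \<le> 1) \<and>
     (\<forall>x. x \<notin> msupp (marginal G) \<longrightarrow> \<eta> x = 1/2)"

definition bayes_classifier :: "(real^'d::finite \<Rightarrow> real) \<Rightarrow> real^'d \<Rightarrow> bool" where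
  "bayes_classifier \<eta> x \<longleftrightarrow> \<not> \<eta> x \<le> 1/2"

definition risk :: "('d::finite) pair measure \<Rightarrow> (real^'d \<Rightarrow> bool) \<Rightarrow> real" where
  "risk G f = measure G {z \<in> space G. snd z \<noteq> f (fst z)}"

(* \<eta> is a regression function of G; the value does not depend on the version. *)
definition excess_risk ::
    "('d::finite) pair measure \<Rightarrow> (real^'d \<Rightarrow> real) \<Rightarrow> (real^'d \<Rightarrow> bool) \<Rightarrow> real" where
  "excess_risk G \<eta> f = risk G f - risk G (bayes_classifier \<eta>)"

definition relative_signal ::
    "(real^'d::finite) set \<Rightarrow> real \<Rightarrow> real \<Rightarrow> (real^'d \<Rightarrow> real) \<Rightarrow> (real^'d \<Rightarrow> real) \<Rightarrow> bool" where
  "relative_signal S g C \<eta>P \<eta>Q \<longleftrightarrow>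
     (\<forall>x\<in>S. (\<eta>P x - 1/2) * (\<eta>Q x - 1/2) \<ge> 0 \<and>
             \<bar>\<eta>P x - 1/2\<bar> \<ge> C * \<bar>\<eta>Q x - 1/2\<bar> powr g)"

definition margin_condition ::
    "real \<Rightarrow> real \<Rightarrow> ('d::finite) pair measure \<Rightarrow> (real^'d \<Rightarrow> real) \<Rightarrow> bool" where
  "margin_condition \<alpha> C G \<eta> \<longleftrightarrow>
     (\<forall>t>0. measure (marginal G) {x. 0 < \<bar>\<eta> x - 1/2\<bar> \<and> \<bar>\<eta> x - 1/2\<bar> < t} \<le> C * t powr \<alpha>)"

definition smooth_on :: "real \<Rightarrow> real \<Rightarrow> (real^'d::finite) set \<Rightarrow> (real^'d \<Rightarrow> real) \<Rightarrow> bool" where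
  "smooth_on \<beta> C S \<eta> \<longleftrightarrow>
     (\<forall>x1\<in>S. \<forall>x2\<in>S. \<bar>\<eta> x1 - \<eta> x2\<bar> \<le> C * norm (x1 - x2) powr \<beta>)"

definition regular_set :: "real \<Rightarrow> real \<Rightarrow> (real^'d::finite) set \<Rightarrow> bool" where
  "regular_set c r0 S \<longleftrightarrow>
     (\<forall>x\<in>S. \<forall>r. 0 < r \<and> r \<le> r0 \<longrightarrow>
        measure lborel (S \<inter> ball x r) \<ge> c * measure lborel (ball x r))"

(* Absolute continuity of the marginal is the existence of a Lebesgue density p. *)
definition density_between ::
    "real \<Rightarrow> real \<Rightarrow> (real^'d::finite) set \<Rightarrow> 'd pair measure \<Rightarrow> bool" where
  "density_between lo hi S G \<longleftrightarrow>
     (\<exists>p :: real^'d \<Rightarrow> real. (\<forall>x. 0 \<le> p x) \<and> distributed G lborel fst (\<lambda>x. ennreal (p x)) \<and>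
        (\<forall>x\<in>S. lo < p x \<and> p x < hi))"

(* Since the conditions on regression functions are pointwise, an element carries the versions
   that satisfy them. Source families are indexed by {1..m} and arbitrary outside it. *)
definition transfer_class ::
    "nat \<Rightarrow> real \<Rightarrow> real \<Rightarrow> real \<Rightarrow> real \<Rightarrow> (nat \<Rightarrow> real) \<Rightarrow> (nat \<Rightarrow> real) \<Rightarrow>
     real \<Rightarrow> real \<Rightarrow> real \<Rightarrow> real \<Rightarrow>
     ((nat \<Rightarrow> ('d::finite) pair measure) \<times> 'd pair measure \<times>
      (nat \<Rightarrow> real^'d \<Rightarrow> real) \<times> (real^'d \<Rightarrow> real)) set" where
  "transfer_class m \<alpha> C\<^sub>\<alpha> \<beta> C\<^sub>\<beta> \<gamma> C \<mu>lo \<mu>hi c\<^sub>\<mu> r\<^sub>\<mu> =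
     {(P, Q, \<eta>P, \<eta>Q).
        (\<forall>i\<in>{1..m}. pair_distribution (P i) \<and> regression_function (P i) (\<eta>P i)) \<and>
        pair_distribution Q \<and> regression_function Q \<eta>Q \<and>
        (\<forall>i\<in>{1..m}. relative_signal (msupp (marginal (P i)) \<union> msupp (marginal Q))
                      (\<gamma> i) (C i) (\<eta>P i) \<eta>Q) \<and>
        margin_condition \<alpha> C\<^sub>\<alpha> Q \<eta>Q \<and>
        smooth_on \<beta> C\<^sub>\<beta> (msupp (marginal Q)) \<eta>Q \<and>
        (\<forall>i\<in>{1..m}. msupp (marginal (P i)) = msupp (marginal Q) \<and>
           regular_set c\<^sub>\<mu> r\<^sub>\<mu> (msupp (marginal Q)) \<and>
           density_between \<mu>lo \<mu>hi (msupp (marginal Q)) (P i) \<and>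
           density_between \<mu>lo \<mu>hi (msupp (marginal Q)) Q)}"

(* A data set is (ZP, ZQ): ZP i j is the j-th pair of source i, ZQ j the j-th pair of the target,
   with j counted from 0. *)
type_synonym 'd data = "(nat \<Rightarrow> nat \<Rightarrow> 'd pair) \<times> (nat \<Rightarrow> 'd pair)"

definition data_measure ::
    "nat \<Rightarrow> (nat \<Rightarrow> nat) \<Rightarrow> nat \<Rightarrow> (nat \<Rightarrow> ('d::finite) pair measure) \<Rightarrow> 'd pair measure \<Rightarrow>
     'd data measure" where
  "data_measure m nP nQ P Q =
     (\<Pi>\<^sub>M i\<in>{1..m}. \<Pi>\<^sub>M j\<in>{..<nP i}. P i) \<Otimes>\<^sub>M (\<Pi>\<^sub>M j\<in>{..<nQ}. Q)"

(* Label of the j-th nearest (j = 1, ..., n) of n covariates to x. The sort is stable, so ties,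
   which have probability zero for marginals with a density, go to the smaller index. *)
definition nn_label :: "nat \<Rightarrow> (nat \<Rightarrow> ('d::finite) pair) \<Rightarrow> real^'d \<Rightarrow> nat \<Rightarrow> real" where
  "nn_label n Z x j = label (snd (Z (sort_key (\<lambda>l. dist (fst (Z l)) x) [0..<n] ! (j - 1))))"

definition effective_size ::
    "nat \<Rightarrow> nat \<Rightarrow> real \<Rightarrow> (nat \<Rightarrow> real) \<Rightarrow> (nat \<Rightarrow> nat) \<Rightarrow> nat \<Rightarrow> real" where
  "effective_size d m \<beta> \<gamma> nP nQ =
     real nQ +
     (\<Sum>i=1..m. real (nP i) powr ((2 * \<beta> + real d) / (2 * \<gamma> i * \<beta> + real d)))"

definition knn_estimate ::
    "nat \<Rightarrow> real \<Rightarrow> (nat \<Rightarrow> real) \<Rightarrow> (nat \<Rightarrow> nat) \<Rightarrow> nat \<Rightarrow> ('d::finite) data \<Rightarrow> real^'d \<Rightarrow> real" where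
  "knn_estimate m \<beta> \<gamma> nP nQ Z x =
     (let d = CARD('d);
          N = effective_size d m \<beta> \<gamma> nP nQ;
          wP = (\<lambda>i. N powr (- (\<gamma> i * \<beta> / (2 * \<beta> + real d))));
          wQ = N powr (- (\<beta> / (2 * \<beta> + real d)));
          kP = (\<lambda>i. nat \<lfloor>real (nP i) * N powr (- (real d / (2 * \<beta> + real d)))\<rfloor>);
          kQ = nat \<lfloor>real nQ * N powr (- (real d / (2 * \<beta> + real d)))\<rfloor>
      in if kQ = 0 \<and> (\<forall>i\<in>{1..m}. kP i = 0) then 1/2
         else (wQ * (\<Sum>j=1..kQ. nn_label nQ (snd Z) x j) +
               (\<Sum>i=1..m. wP i * (\<Sum>j=1..kP i. nn_label (nP i) (fst Z i) x j))) /
              (wQ * real kQ + (\<Sum>i=1..m. wP i * real (kP i))))"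

definition knn_classifier ::
    "nat \<Rightarrow> real \<Rightarrow> (nat \<Rightarrow> real) \<Rightarrow> (nat \<Rightarrow> nat) \<Rightarrow> nat \<Rightarrow> ('d::finite) data \<Rightarrow> real^'d \<Rightarrow> bool" where
  "knn_classifier m \<beta> \<gamma> nP nQ Z x \<longleftrightarrow> knn_estimate m \<beta> \<gamma> nP nQ Z x > 1/2"

end

theory Submission
  imports Defs
begin

text \<open>
  Let \<open>N\<close> be the effective sample size, \<open>d\<close> the dimension, \<open>h = N powr (- 1 / (2 * \<beta> + d))\<close> and
  \<open>\<tau> = h powr \<beta>\<close>. A source with transfer exponent \<open>g\<close> gets the weight \<open>w = \<tau> powr g\<close> and uses about \<open>n * h ^ d\<close>
  of its \<open>n\<close> points; the target is treated as a source with \<open>g = 1\<close>. The error probability is bounded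
  separately at each \<open>x\<close>, in terms of the margin \<open>\<bar>\<eta>Q x - 1/2\<bar> = t * \<tau>\<close>, and then integrated.

  Let \<open>x\<close> lie in the support with \<open>t\<close> large. On a ball of radius of order \<open>t powr (1 / \<beta>) * h\<close> smoothness
  keeps \<open>\<eta>Q\<close> on the same side of one half with at least half of the margin, and the relative signal
  condition gives the regression function of each source a bias of order at least \<open>t powr g' * w\<close> to that
  side, where \<open>g'\<close> is a common lower bound of the exponents (\<open>local_gaps\<close>). A wrong decision has two
  possible reasons. The selected neighbours of some sample may not all lie in the ball; the expected
  number of sample points there exceeds the required number by a factor of order \<open>t powr (d / \<beta>)\<close>, so a
  Chernoff bound makes this exponentially unlikely in that factor (\<open>far_prob\<close>). Or all selected
  neighbours lie in the ball and the weighted vote still goes the wrong way. Since neighbours are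
  selected by their covariates, the selected labels are conditionally independent, and Hoeffding's lemma bounds the
  exponential moment of the vote (\<open>nn_label_exp_moment\<close>). The weights equalize signal and noise: both
  the mean and the variance of the share of a source are proportional to \<open>w\<^sup>2 * k\<close>, with \<open>k\<close> its number of
  neighbours, and the sum of these terms is bounded below by a constant for large \<open>N\<close>
  (\<open>total_signal\<close>). Together the error probability at \<open>x\<close> is at most exponential in a negative multiple
  of a power of \<open>t\<close>, with constants independent of the sample sizes, hence of order
  \<open>t powr (- (2 + \<alpha>))\<close> (\<open>pointwise_polynomial_error\<close>).

  The expected excess risk is the integral of twice the margin times this probability. Summing over
  dyadic shells of the margin, whose mass the margin condition controls, gives the order
  \<open>\<tau> powr (1 + \<alpha>)\<close> (\<open>margin_shell_integral\<close>), which is the claimed rate. For bounded \<open>N\<close> the claim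
  is trivial, as the excess risk is at most 1.
\<close>

section \<open>Measurability of nearest neighbours\<close>

lemma space_pair_distribution: "sets G = sets pair_space \<Longrightarrow> space G = UNIV"
  using sets_eq_imp_space_eq[of G pair_space] by (simp add: space_pair_measure)

lemma measurable_pair_projections:
  fixes G :: "('d::finite) pair measure"
  assumes "sets G = sets pair_space"
  shows "fst \<in> measurable G borel" and "snd \<in> measurable G (count_space UNIV)"
  by (subst measurable_cong_sets[OF assms refl], simp)+

text \<open>
  Insertion into a sorted list decides finitely many comparisons of keys, each a measurable event, and
  there are only countably many lists.
\<close>

lemma measurable_insort_key:
  fixes f :: "'a \<Rightarrow> 'b::countable \<Rightarrow> real"
  assumes f: "\<And>l. (\<lambda>\<omega>. f \<omega> l) \<in> borel_measurable M"
  shows "(\<lambda>\<omega>. insort_key (f \<omega>) a L) \<in> measurable M (count_space UNIV)"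
proof (induction L)
  case (Cons b L)
  note [measurable] = f Cons
  have "(\<lambda>\<omega>. b # insort_key (f \<omega>) a L) \<in> measurable M (count_space UNIV)"
    by (rule measurable_compose[OF Cons]) simp
  then have "(\<lambda>\<omega>. if f \<omega> a \<le> f \<omega> b then a # b # L else b # insort_key (f \<omega>) a L)
      \<in> measurable M (count_space UNIV)"
    by (intro measurable_If) auto
  then show ?case by simp
qed simp

lemma measurable_sort_key:
  fixes f :: "'a \<Rightarrow> 'b::countable \<Rightarrow> real"
  assumes f: "\<And>l. (\<lambda>\<omega>. f \<omega> l) \<in> borel_measurable M"
  shows "(\<lambda>\<omega>. sort_key (f \<omega>) xs) \<in> measurable M (count_space UNIV)"
proof (induction xs)
  case (Cons a xs)
  have "(\<lambda>\<omega>. insort_key (f \<omega>) a (sort_key (f \<omega>) xs)) \<in> measurable M (count_space UNIV)"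
    by (rule measurable_compose_countable[OF measurable_insort_key[OF f] Cons])
  then show ?case by simp
qed (simp add: sort_key_def)

text \<open>
  A coordinate outside the index set is constantly \<open>undefined\<close> on the product space.
\<close>

lemma measurable_PiM_coordinate:
  assumes "space N = UNIV"
  shows "(\<lambda>\<omega>. \<omega> l) \<in> measurable (PiM I (\<lambda>_. N)) N"
proof (cases "l \<in> I")
  case False
  have "(\<lambda>\<omega>. \<omega> l) \<in> measurable (PiM I (\<lambda>_. N)) N \<longleftrightarrow>
      (\<lambda>\<omega>. undefined) \<in> measurable (PiM I (\<lambda>_. N)) N"
    using False by (intro measurable_cong) (auto simp: space_PiM)
  then show ?thesis using assms by simp
qed (rule measurable_component_singleton)

definition nn_order :: "nat \<Rightarrow> (nat \<Rightarrow> ('d::finite) pair) \<Rightarrow> real^'d \<Rightarrow> nat list" where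
  "nn_order n Z x = sort_key (\<lambda>l. dist (fst (Z l)) x) [0..<n]"

lemma set_nn_order [simp]: "set (nn_order n Z x) = {0..<n}"
  and length_nn_order [simp]: "length (nn_order n Z x) = n"
  and distinct_nn_order [simp]: "distinct (nn_order n Z x)"
  by (simp_all add: nn_order_def)

lemma sorted_nn_order: "sorted (map (\<lambda>l. dist (fst (Z l)) x) (nn_order n Z x))"
  by (simp add: nn_order_def)

lemma nn_label_nn_order: "nn_label n Z x j = label (snd (Z (nn_order n Z x ! (j - 1))))"
  by (simp add: nn_label_def nn_order_def)

lemma measurable_nn_order:
  fixes G :: "('d::finite) pair measure"
  assumes "sets G = sets pair_space"
  shows "(\<lambda>(Z, x). nn_order n Z x) \<in> measurable (PiM {..<n} (\<lambda>_. G) \<Otimes>\<^sub>M borel) (count_space UNIV)"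
proof -
  note [measurable] = measurable_pair_projections(1)[OF assms]
    measurable_PiM_coordinate[OF space_pair_distribution[OF assms]]
  show ?thesis
    unfolding nn_order_def split_beta by (intro measurable_sort_key) measurable
qed

lemma measurable_nn_label:
  fixes G :: "('d::finite) pair measure"
  assumes "sets G = sets pair_space"
  shows "(\<lambda>(Z, x). nn_label n Z x j) \<in> borel_measurable (PiM {..<n} (\<lambda>_. G) \<Otimes>\<^sub>M borel)"
proof -
  note [measurable] = measurable_pair_projections(2)[OF assms]
    measurable_PiM_coordinate[OF space_pair_distribution[OF assms]]
  have "(\<lambda>p. (case p of (Z, x) \<Rightarrow> nn_order n Z x) ! (j - 1))
      \<in> measurable (PiM {..<n} (\<lambda>_. G) \<Otimes>\<^sub>M borel) (count_space UNIV)"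
    by (rule measurable_compose[OF measurable_nn_order[OF assms]]) simp
  then have "(\<lambda>p. label (snd (fst p ((case p of (Z, x) \<Rightarrow> nn_order n Z x) ! (j - 1)))))
      \<in> borel_measurable (PiM {..<n} (\<lambda>_. G) \<Otimes>\<^sub>M borel)"
    by (rule measurable_compose_countable[rotated]) measurable
  then show ?thesis by (simp add: nn_label_nn_order split_beta)
qed

definition k_nearest_in :: "nat \<Rightarrow> nat \<Rightarrow> real^'d \<Rightarrow> (real^'d) set \<Rightarrow> (nat \<Rightarrow> ('d::finite) pair) set" where
  "k_nearest_in n k x A = {Z. \<forall>j<k. fst (Z (nn_order n Z x ! j)) \<in> A}"

lemma measurable_nn_order_at:
  fixes G :: "('d::finite) pair measure"
  assumes sG: "sets G = sets pair_space"
  shows "(\<lambda>Z. nn_order n Z x) \<in> measurable (PiM {..<n} (\<lambda>_. G)) (count_space UNIV)"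
  using measurable_compose[OF measurable_Pair2' measurable_nn_order[OF sG]] by simp

lemma measurable_nn_label_at:
  fixes G :: "('d::finite) pair measure"
  assumes sG: "sets G = sets pair_space"
  shows "(\<lambda>Z. nn_label n Z x j) \<in> borel_measurable (PiM {..<n} (\<lambda>_. G))"
  using measurable_compose[OF measurable_Pair2' measurable_nn_label[OF sG]] by simp

lemma pred_k_nearest_in:
  fixes G :: "('d::finite) pair measure"
  assumes sG: "sets G = sets pair_space" and A: "A \<in> sets borel"
  shows "Measurable.pred (PiM {..<n} (\<lambda>_. G)) (\<lambda>Z. Z \<in> k_nearest_in n k x A)"
proof -
  note [measurable] = measurable_pair_projections(1)[OF sG] A
    measurable_PiM_coordinate[OF space_pair_distribution[OF sG]]
  have "Measurable.pred (PiM {..<n} (\<lambda>_. G)) (\<lambda>Z. fst (Z l) \<in> A)" for l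
    by measurable
  then have "(\<lambda>Z. fst (Z (nn_order n Z x ! j)) \<in> A) \<in> measurable (PiM {..<n} (\<lambda>_. G)) (count_space UNIV)" for j
    by (rule measurable_compose_countable) (rule measurable_compose[OF measurable_nn_order_at[OF sG]], simp)
  then show ?thesis
    unfolding k_nearest_in_def mem_Collect_eq by measurable
qed

section \<open>Regression functions, supports and excess risk\<close>

lemma sets_marginal [simp]: "sets (marginal G) = sets borel"
  and space_marginal [simp]: "space (marginal G) = UNIV"
  by (simp_all add: marginal_def)

lemma pair_distribution_sets: "pair_distribution G \<Longrightarrow> sets G = sets pair_space"
  by (simp add: pair_distribution_def)

lemma prob_space_marginal:
  fixes G :: "('d::finite) pair measure"
  assumes "pair_distribution G"
  shows "prob_space (marginal G)"
proof -
  interpret prob_space G using assms by (simp add: pair_distribution_def)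
  show ?thesis
    unfolding marginal_def
    by (intro prob_space_distr measurable_pair_projections pair_distribution_sets assms)
qed

text \<open>
  Conditional on the covariate, the label is Bernoulli with parameter \<open>\<eta>\<close>. This form, with an
  arbitrary nonnegative function of the covariate, is how the regression function enters
  the error bounds and the excess risk.
\<close>

lemma nn_integral_label:
  fixes G :: "('d::finite) pair measure" and u :: "real^'d \<Rightarrow> ennreal" and f :: "bool \<Rightarrow> ennreal"
  assumes G: "pair_distribution G" and \<eta>: "regression_function G \<eta>"
    and u: "u \<in> borel_measurable borel"
  shows "(\<integral>\<^sup>+z. u (fst z) * f (snd z) \<partial>G) =
    (\<integral>\<^sup>+z. u (fst z) * (ennreal (\<eta> (fst z)) * f True + ennreal (1 - \<eta> (fst z)) * f False) \<partial>G)"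
proof -
  interpret prob_space G using G by (simp add: pair_distribution_def)
  have sG: "sets G = sets pair_space" using G by (simp add: pair_distribution_def)
  have spG: "space G = UNIV" by (rule space_pair_distribution[OF sG])
  note m1[measurable] = measurable_pair_projections(1)[OF sG]
  note m2[measurable] = measurable_pair_projections(2)[OF sG]
  have m\<eta>[measurable]: "\<eta> \<in> borel_measurable borel"
    and r\<eta>: "\<And>x. 0 \<le> \<eta> x" "\<And>x. \<eta> x \<le> 1"
    using \<eta> by (auto simp: regression_function_def)
  let ?F = "vimage_algebra (space G) fst borel :: 'd pair measure"
  have sub: "subalgebra G ?F"
    unfolding subalgebra_def
    by (subst sets_vimage_algebra2) (auto intro: measurable_sets[OF m1])
  interpret F: finite_measure_subalgebra G ?F
    by unfold_locales (rule sub)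
  have int: "integrable G (\<lambda>z. label (snd z))"
    by (rule integrable_const_bound[where B = 1]) (auto simp: label_def)
  have int\<eta>: "integrable G (\<lambda>z. \<eta> (fst z))"
    by (rule integrable_const_bound[where B = 1]) (auto simp: r\<eta>)
  have AE: "AE z in G. \<eta> (fst z) = real_cond_exp G ?F (\<lambda>z. label (snd z)) z"
    using \<eta> by (simp add: regression_function_def)
  \<comment> \<open>Comparing these two covariate laws on sets is all that the conditional expectation provides;
    equality as measures then covers every integrand at once.\<close>
  define M1 where "M1 b = distr (density G (\<lambda>z. of_bool (snd z = b))) borel fst" for b
  define M2 where "M2 b = distr (density G (\<lambda>z. ennreal (if b then \<eta> (fst z) else 1 - \<eta> (fst z)))) borel fst" for b
  have eq: "M1 b = M2 b" for b
  proof (rule measure_eqI)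
    show "sets (M1 b) = sets (M2 b)" by (simp add: M1_def M2_def)
    fix D assume "D \<in> sets (M1 b)"
    then have D[measurable]: "D \<in> sets borel" by (simp add: M1_def)
    have DF: "fst -` D \<inter> space G \<in> sets ?F" by (rule in_vimage_algebra) (rule D)
    have DG[measurable]: "fst -` D \<inter> space G \<in> sets G" by measurable
    have i1: "set_integrable G (fst -` D \<inter> space G) (\<lambda>z. label (snd z))"
      unfolding set_integrable_def using int by (intro integrable_mult_indicator) auto
    have i2: "set_integrable G (fst -` D \<inter> space G) (\<lambda>z. \<eta> (fst z))"
      unfolding set_integrable_def using int\<eta> by (intro integrable_mult_indicator) auto
    have i0: "set_integrable G (fst -` D \<inter> space G) (\<lambda>z. 1)"
      unfolding set_integrable_def using integrable_mult_indicator[OF DG, of "\<lambda>_. 1 :: real"] by simp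
    have I: "(\<integral>z\<in>fst -` D \<inter> space G. label (snd z) \<partial>G) = (\<integral>z\<in>fst -` D \<inter> space G. \<eta> (fst z) \<partial>G)"
      unfolding F.real_cond_exp_intA[OF int DF]
      using AE by (intro set_lebesgue_integral_cong_AE) (auto intro: borel_measurable_integrable F.real_cond_exp_int[OF int])
    have I': "(\<integral>z\<in>fst -` D \<inter> space G. 1 - label (snd z) \<partial>G) = (\<integral>z\<in>fst -` D \<inter> space G. 1 - \<eta> (fst z) \<partial>G)"
      using set_integral_diff(2)[OF i0 i1] set_integral_diff(2)[OF i0 i2] I by simp
    have l1: "emeasure (M1 b) D = ennreal (\<integral>z\<in>fst -` D \<inter> space G. (if b then label (snd z) else 1 - label (snd z)) \<partial>G)"
    proof -
      have "emeasure (M1 b) D = (\<integral>\<^sup>+z. of_bool (snd z = b) * indicator (fst -` D \<inter> space G) z \<partial>G)"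
        by (simp add: M1_def emeasure_distr emeasure_density)
      also have "\<dots> = (\<integral>\<^sup>+z. ennreal (indicator (fst -` D \<inter> space G) z *\<^sub>R (if b then label (snd z) else 1 - label (snd z))) \<partial>G)"
        by (intro nn_integral_cong) (auto simp: label_def indicator_def)
      also have "\<dots> = ennreal (\<integral>z\<in>fst -` D \<inter> space G. (if b then label (snd z) else 1 - label (snd z)) \<partial>G)"
        unfolding set_lebesgue_integral_def
      proof (rule nn_integral_eq_integral)
        show "integrable G (\<lambda>z. indicat_real (fst -` D \<inter> space G) z *\<^sub>R (if b then label (snd z) else 1 - label (snd z)))"
          using i1 set_integral_diff(1)[OF i0 i1] by (cases b) (simp_all add: set_integrable_def)
      qed (auto simp: label_def indicator_def)
      finally show ?thesis .
    qed
    have l2: "emeasure (M2 b) D = ennreal (\<integral>z\<in>fst -` D \<inter> space G. (if b then \<eta> (fst z) else 1 - \<eta> (fst z)) \<partial>G)"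
    proof -
      have "emeasure (M2 b) D = (\<integral>\<^sup>+z. ennreal (if b then \<eta> (fst z) else 1 - \<eta> (fst z)) * indicator (fst -` D \<inter> space G) z \<partial>G)"
        by (simp add: M2_def emeasure_distr emeasure_density)
      also have "\<dots> = (\<integral>\<^sup>+z. ennreal (indicator (fst -` D \<inter> space G) z *\<^sub>R (if b then \<eta> (fst z) else 1 - \<eta> (fst z))) \<partial>G)"
        by (intro nn_integral_cong) (auto simp: indicator_def)
      also have "\<dots> = ennreal (\<integral>z\<in>fst -` D \<inter> space G. (if b then \<eta> (fst z) else 1 - \<eta> (fst z)) \<partial>G)"
        unfolding set_lebesgue_integral_def
      proof (rule nn_integral_eq_integral)
        show "integrable G (\<lambda>z. indicat_real (fst -` D \<inter> space G) z *\<^sub>R (if b then \<eta> (fst z) else 1 - \<eta> (fst z)))"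
          using i2 set_integral_diff(1)[OF i0 i2] by (cases b) (simp_all add: set_integrable_def)
      qed (auto simp: indicator_def r\<eta>)
      finally show ?thesis .
    qed
    show "emeasure (M1 b) D = emeasure (M2 b) D"
      unfolding l1 l2 using I I' by (cases b) auto
  qed
  have e1: "(\<integral>\<^sup>+x. u x \<partial>M1 b) = (\<integral>\<^sup>+z. u (fst z) * of_bool (snd z = b) \<partial>G)" for b
    using u by (simp add: M1_def nn_integral_distr nn_integral_density mult.commute)
  have e2: "(\<integral>\<^sup>+x. u x \<partial>M2 b) = (\<integral>\<^sup>+z. u (fst z) * ennreal (if b then \<eta> (fst z) else 1 - \<eta> (fst z)) \<partial>G)" for b
    using u by (simp add: M2_def nn_integral_distr nn_integral_density mult.commute)
  note u[measurable]
  have "(\<integral>\<^sup>+z. u (fst z) * f (snd z) \<partial>G) =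
      (\<integral>\<^sup>+z. (u (fst z) * of_bool (snd z = True)) * f True + (u (fst z) * of_bool (snd z = False)) * f False \<partial>G)"
    by (intro nn_integral_cong) auto
  also have "\<dots> = (\<integral>\<^sup>+x. u x \<partial>M1 True) * f True + (\<integral>\<^sup>+x. u x \<partial>M1 False) * f False"
    unfolding e1 by (subst nn_integral_add) (simp_all add: nn_integral_multc)
  also have "\<dots> = (\<integral>\<^sup>+z. u (fst z) * ennreal (\<eta> (fst z)) * f True + u (fst z) * ennreal (1 - \<eta> (fst z)) * f False \<partial>G)"
    unfolding eq e2 by (subst nn_integral_add) (simp_all add: nn_integral_multc)
  finally show ?thesis by (simp add: distrib_left mult.assoc)
qed

text \<open>
  Deviating from the Bayes rule at \<open>x\<close> costs twice the distance of \<open>\<eta> x\<close> from one half.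
\<close>

lemma excess_risk_nn_integral:
  fixes G :: "('d::finite) pair measure"
  assumes G: "pair_distribution G" and \<eta>: "regression_function G \<eta>"
    and f[measurable]: "Measurable.pred borel f"
  shows "ennreal (excess_risk G \<eta> f) =
      (\<integral>\<^sup>+z. ennreal (2 * \<bar>\<eta> (fst z) - 1/2\<bar>) * of_bool (f (fst z) \<noteq> bayes_classifier \<eta> (fst z)) \<partial>G)"
    and "0 \<le> excess_risk G \<eta> f"
proof -
  interpret prob_space G using G by (simp add: pair_distribution_def)
  have sG: "sets G = sets pair_space" using G by (simp add: pair_distribution_def)
  note [measurable] = measurable_pair_projections[OF sG]
  have m\<eta>[measurable]: "\<eta> \<in> borel_measurable borel"
    and r\<eta>: "\<And>x. 0 \<le> \<eta> x" "\<And>x. \<eta> x \<le> 1"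
    using \<eta> by (auto simp: regression_function_def)
  have [measurable]: "Measurable.pred borel (bayes_classifier \<eta>)"
    unfolding bayes_classifier_def by measurable
  define \<rho> where "\<rho> h x = (if h x then 1 - \<eta> x else \<eta> x)" for h x
  have int: "integrable G (\<lambda>z. \<rho> h (fst z))" if [measurable]: "Measurable.pred borel h" for h
    by (rule integrable_const_bound[where B = 1]) (auto simp: \<rho>_def r\<eta>)
  have risk: "risk G h = (\<integral>z. \<rho> h (fst z) \<partial>G)" if [measurable]: "Measurable.pred borel h" for h
  proof -
    have "ennreal (risk G h) = (\<integral>\<^sup>+z. indicator {z \<in> space G. snd z \<noteq> h (fst z)} z \<partial>G)"
      by (simp add: risk_def emeasure_eq_measure)
    also have "\<dots> = (\<integral>\<^sup>+z. of_bool (h (fst z)) * of_bool (\<not> snd z) + of_bool (\<not> h (fst z)) * of_bool (snd z) \<partial>G)"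
      by (intro nn_integral_cong) (auto simp: indicator_def)
    also have "\<dots> = (\<integral>\<^sup>+z. of_bool (h (fst z)) * of_bool (\<not> snd z) \<partial>G) + (\<integral>\<^sup>+z. of_bool (\<not> h (fst z)) * of_bool (snd z) \<partial>G)"
      by (rule nn_integral_add) auto
    also have "\<dots> = (\<integral>\<^sup>+z. of_bool (h (fst z)) * ennreal (1 - \<eta> (fst z)) \<partial>G) + (\<integral>\<^sup>+z. of_bool (\<not> h (fst z)) * ennreal (\<eta> (fst z)) \<partial>G)"
      by (subst (1 2) nn_integral_label[OF G \<eta>]) auto
    also have "\<dots> = (\<integral>\<^sup>+z. of_bool (h (fst z)) * ennreal (1 - \<eta> (fst z)) + of_bool (\<not> h (fst z)) * ennreal (\<eta> (fst z)) \<partial>G)"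
      by (rule nn_integral_add[symmetric]) auto
    also have "\<dots> = (\<integral>\<^sup>+z. ennreal (\<rho> h (fst z)) \<partial>G)"
      by (intro nn_integral_cong) (auto simp: \<rho>_def)
    also have "\<dots> = ennreal (\<integral>z. \<rho> h (fst z) \<partial>G)"
      using int[OF that] by (rule nn_integral_eq_integral) (auto simp: \<rho>_def r\<eta>)
    finally show ?thesis
      by (subst (asm) ennreal_inj) (auto simp: risk_def \<rho>_def r\<eta> intro!: integral_nonneg_AE)
  qed
  let ?d = "\<lambda>z. 2 * \<bar>\<eta> (fst z) - 1/2\<bar> * of_bool (f (fst z) \<noteq> bayes_classifier \<eta> (fst z))"
  have "excess_risk G \<eta> f = (\<integral>z. \<rho> f (fst z) - \<rho> (bayes_classifier \<eta>) (fst z) \<partial>G)"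
    unfolding excess_risk_def by (simp add: risk int)
  also have "\<dots> = (\<integral>z. ?d z \<partial>G)"
    by (intro Bochner_Integration.integral_cong refl) (auto simp: \<rho>_def bayes_classifier_def abs_if)
  finally have eq: "excess_risk G \<eta> f = (\<integral>z. ?d z \<partial>G)" .
  then show "0 \<le> excess_risk G \<eta> f" by (auto intro!: integral_nonneg_AE)
  have int_d: "(\<integral>\<^sup>+z. ennreal (?d z) \<partial>G) = ennreal (\<integral>z. ?d z \<partial>G)"
  proof (rule nn_integral_eq_integral)
    show "integrable G ?d"
    proof (rule integrable_const_bound[where B = 1])
      have "2 * \<bar>\<eta> y - 1/2\<bar> \<le> 1" for y using r\<eta>[of y] by (auto simp: abs_if)
      then show "AE z in G. norm (?d z) \<le> 1" by (auto simp: abs_mult)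
    qed measurable
  qed auto
  have d: "ennreal (?d z) = ennreal (2 * \<bar>\<eta> (fst z) - 1/2\<bar>) * of_bool (f (fst z) \<noteq> bayes_classifier \<eta> (fst z))" for z
    by auto
  show "ennreal (excess_risk G \<eta> f) =
      (\<integral>\<^sup>+z. ennreal (2 * \<bar>\<eta> (fst z) - 1/2\<bar>) * of_bool (f (fst z) \<noteq> bayes_classifier \<eta> (fst z)) \<partial>G)"
    unfolding eq int_d[symmetric] by (intro nn_integral_cong d)
qed

text \<open>
  The complement of the support is a union of null balls, and by the Lindelof property countably
  many of them suffice.
\<close>

lemma AE_msupp_marginal:
  fixes G :: "('d::finite) pair measure"
  assumes G: "pair_distribution G"
  shows "AE z in G. fst z \<in> msupp (marginal G)"
proof -
  interpret prob_space G using G by (simp add: pair_distribution_def)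
  note [measurable] = measurable_pair_projections(1)[OF pair_distribution_sets[OF G]]
  interpret X: prob_space "marginal G" by (rule prob_space_marginal[OF G])
  define F where "F = {ball x r |(x::real^'d) r. r > 0 \<and> measure (marginal G) (ball x r) = 0}"
  obtain F' where F': "F' \<subseteq> F" "countable F'" "\<Union>F' = \<Union>F"
    by (rule Lindelof[of F]) (auto simp: F_def)
  have "AE x in marginal G. \<forall>B\<in>F'. x \<notin> B"
  proof (subst AE_ball_countable[OF F'(2)], rule ballI)
    fix B assume "B \<in> F'"
    with F'(1) have "B \<in> sets (marginal G)" "measure (marginal G) B = 0"
      by (auto simp: F_def marginal_def)
    then have "B \<in> null_sets (marginal G)" by (simp add: X.emeasure_eq_measure null_setsI)
    then show "AE x in marginal G. x \<notin> B" by (rule AE_not_in)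
  qed
  then have "AE x in marginal G. x \<in> msupp (marginal G)"
  proof eventually_elim
    case (elim x)
    then have "x \<notin> \<Union>F" using F'(3) by auto
    then show ?case
      by (auto simp: msupp_def F_def) (metis centre_in_ball measure_nonneg order_le_less)
  qed
  then show ?thesis
    unfolding marginal_def by (rule AE_distrD[rotated]) simp
qed

lemma closed_msupp:
  fixes M :: "'a::metric_space measure"
  assumes "finite_measure M" "sets M = sets borel"
  shows "closed (msupp M)"
proof -
  interpret finite_measure M by fact
  have "open (- msupp M)"
    unfolding open_contains_ball
  proof safe
    fix x assume "x \<notin> msupp M"
    then obtain r where r: "r > 0" "measure M (ball x r) \<le> 0" by (auto simp: msupp_def not_less)
    have "ball x r \<subseteq> - msupp M"
    proof
      fix y assume y: "y \<in> ball x r"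
      then obtain e where e: "e > 0" "ball y e \<subseteq> ball x r"
        by (meson open_ball open_contains_ball)
      have "measure M (ball y e) \<le> measure M (ball x r)"
        using e by (intro finite_measure_mono) (auto simp: assms)
      then show "y \<in> - msupp M" using e r by (auto simp: msupp_def not_less intro!: exI[of _ e])
    qed
    then show "\<exists>e>0. ball x e \<subseteq> - msupp M" using r by auto
  qed
  then show ?thesis by (simp add: closed_def)
qed

lemma closed_msupp_marginal:
  assumes "pair_distribution G"
  shows "closed (msupp (marginal G))"
  using prob_space_marginal[OF assms] by (intro closed_msupp) (auto simp: prob_space_def)

section \<open>Labels of nearest neighbours\<close>

text \<open>
  Hoeffding's lemma for a Bernoulli variable, centred at one half instead of at its mean; the
  difference of the two centres is the linear term.
\<close>

lemma two_point_hoeffding: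
  fixes p u :: real
  assumes p: "0 \<le> p" "p \<le> 1"
  shows "p * exp (- u / 2) + (1 - p) * exp (u / 2) \<le> exp (u\<^sup>2 / 8 - u * (p - 1/2))"
proof -
  have nonneg: "q * exp (- v / 2) + (1 - q) * exp (v / 2) \<le> exp (v\<^sup>2 / 8 - v * (q - 1/2))"
    if "0 \<le> q" "q \<le> 1" "0 \<le> v" for q v :: real
  proof -
    have pos: "0 < 1 + (1 - q) * (exp v - 1)"
      using that by (intro add_pos_nonneg mult_nonneg_nonneg) auto
    have "ln (1 + (1 - q) * (exp v - 1)) \<le> v\<^sup>2 / 8 + v * (1 - q)"
      using Hoeffdings_lemma_aux[of v "1 - q"] that by simp
    then have "exp (ln (1 + (1 - q) * (exp v - 1))) \<le> exp (v\<^sup>2 / 8 + v * (1 - q))"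
      by (rule iffD2[OF exp_le_cancel_iff])
    then have "1 + (1 - q) * (exp v - 1) \<le> exp (v\<^sup>2 / 8 + v * (1 - q))"
      using pos by simp
    then have "exp (- v / 2) * (1 + (1 - q) * (exp v - 1)) \<le> exp (- v / 2) * exp (v\<^sup>2 / 8 + v * (1 - q))"
      by (intro mult_left_mono) auto
    moreover have "exp (- v / 2) * (1 + (1 - q) * (exp v - 1)) = q * exp (- v / 2) + (1 - q) * exp (v / 2)"
    proof -
      have "exp (- v / 2) * exp v = exp (v / 2)" by (simp flip: exp_add)
      then show ?thesis by (simp add: algebra_simps)
    qed
    moreover have "exp (- v / 2) * exp (v\<^sup>2 / 8 + v * (1 - q)) = exp (v\<^sup>2 / 8 - v * (q - 1/2))"
      by (simp flip: exp_add) (simp add: algebra_simps)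
    ultimately show ?thesis by metis
  qed
  show ?thesis
  proof (cases "0 \<le> u")
    case True then show ?thesis using nonneg p by simp
  next
    case False
    then have "(1 - p) * exp (- (- u) / 2) + (1 - (1 - p)) * exp (- u / 2)
        \<le> exp ((- u)\<^sup>2 / 8 - (- u) * ((1 - p) - 1/2))"
      using p by (intro nonneg) auto
    then show ?thesis by (simp add: algebra_simps)
  qed
qed

text \<open>
  Integrating one observation out first: if the rest of the integrand sees only the covariate of this
  observation, a conditional bound \<open>c\<close> on its factor \<open>V\<close> can be pulled out of the whole integral. This
  replaces conditioning on the covariates.
\<close>

lemma nn_integral_coordinate_le:
  fixes G :: "('a \<times> bool) measure" and H :: "(nat \<Rightarrow> 'a \<times> bool) \<Rightarrow> ennreal" and N :: "'a measure"
  assumes G: "prob_space G" and sG: "sets G = sets (N \<Otimes>\<^sub>M count_space UNIV)"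
    and V[measurable]: "V \<in> borel_measurable G"
    and H[measurable]: "H \<in> borel_measurable (PiM I (\<lambda>_. G))"
    and I: "finite I" "a \<in> I"
    and dep: "\<And>w x y y'. H (w(a := (x, y))) = H (w(a := (x, y')))"
    and le: "\<And>u. u \<in> borel_measurable N \<Longrightarrow>
        (\<integral>\<^sup>+z. u (fst z) * V z \<partial>G) \<le> c * (\<integral>\<^sup>+z. u (fst z) \<partial>G)"
  shows "(\<integral>\<^sup>+w. H w * V (w a) \<partial>PiM I (\<lambda>_. G)) \<le> c * (\<integral>\<^sup>+w. H w \<partial>PiM I (\<lambda>_. G))"
proof -
  interpret prob_space G by fact
  interpret product_sigma_finite "\<lambda>_::nat. G" by unfold_locales
  define J where "J = I - {a}"
  have J: "finite J" "a \<notin> J" "I = insert a J" using I by (auto simp: J_def)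
  note [measurable] = H[unfolded J(3)]
  have "(\<integral>\<^sup>+w. H w * V (w a) \<partial>PiM I (\<lambda>_. G)) =
      (\<integral>\<^sup>+w. (\<integral>\<^sup>+z. H (w(a := z)) * V z \<partial>G) \<partial>PiM J (\<lambda>_. G))"
    unfolding J(3) by (subst product_nn_integral_insert[OF J(1,2)]) simp_all
  also have "\<dots> \<le> (\<integral>\<^sup>+w. c * (\<integral>\<^sup>+z. H (w(a := z)) \<partial>G) \<partial>PiM J (\<lambda>_. G))"
  proof (rule nn_integral_mono)
    fix w assume w: "w \<in> space (PiM J (\<lambda>_. G))"
    have "(\<lambda>x. (x, True)) \<in> measurable N G"
      by (subst measurable_cong_sets[OF refl sG]) simp
    then have "(\<lambda>x. H (w(a := (x, True)))) \<in> borel_measurable N"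
      using measurable_component_update[OF w J(2)] by measurable
    from le[OF this] show "(\<integral>\<^sup>+z. H (w(a := z)) * V z \<partial>G) \<le> c * (\<integral>\<^sup>+z. H (w(a := z)) \<partial>G)"
      using dep[of w] by (metis (no_types, lifting) nn_integral_cong prod.collapse)
  qed
  also have "\<dots> = c * (\<integral>\<^sup>+w. (\<integral>\<^sup>+z. H (w(a := z)) \<partial>G) \<partial>PiM J (\<lambda>_. G))"
    by (rule nn_integral_cmult) measurable
  also have "\<dots> = c * (\<integral>\<^sup>+w. H w \<partial>PiM I (\<lambda>_. G))"
    unfolding J(3) by (subst product_nn_integral_insert[OF J(1,2)]) simp_all
  finally show ?thesis .
qed

text \<open>
  Iterates the previous bound over the coordinates in \<open>J\<close>. A factor that has not been removed yet
  depends on its own coordinate only, so it does not disturb the step for another one.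
\<close>

lemma nn_integral_coordinates_le:
  fixes G :: "('a \<times> bool) measure" and F :: "(nat \<Rightarrow> 'a \<times> bool) \<Rightarrow> ennreal" and N :: "'a measure"
  assumes G: "prob_space G" and sG: "sets G = sets (N \<Otimes>\<^sub>M count_space UNIV)"
    and V[measurable]: "V \<in> borel_measurable G"
    and F[measurable]: "F \<in> borel_measurable (PiM I (\<lambda>_. G))"
    and I: "finite I" "J \<subseteq> I"
    and dep: "\<And>w a x y y'. F (w(a := (x, y))) = F (w(a := (x, y')))"
    and le: "\<And>u. u \<in> borel_measurable N \<Longrightarrow>
        (\<integral>\<^sup>+z. u (fst z) * V z \<partial>G) \<le> c * (\<integral>\<^sup>+z. u (fst z) \<partial>G)"
  shows "(\<integral>\<^sup>+w. F w * (\<Prod>j\<in>J. V (w j)) \<partial>PiM I (\<lambda>_. G)) \<le> c ^ card J * (\<integral>\<^sup>+w. F w \<partial>PiM I (\<lambda>_. G))"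
proof -
  have "finite J" using I finite_subset by blast
  then show ?thesis using I(2)
  proof (induction J)
    case (insert a J)
    have VJ: "(\<lambda>w. V (w j)) \<in> borel_measurable (PiM I (\<lambda>_. G))" if "j \<in> J" for j
    proof -
      have "j \<in> I" using that insert.prems by auto
      then show ?thesis by measurable
    qed
    have "(\<integral>\<^sup>+w. F w * (\<Prod>j\<in>insert a J. V (w j)) \<partial>PiM I (\<lambda>_. G)) =
        (\<integral>\<^sup>+w. F w * (\<Prod>j\<in>J. V (w j)) * V (w a) \<partial>PiM I (\<lambda>_. G))"
      using insert.hyps by (simp add: ac_simps)
    also have "\<dots> \<le> c * (\<integral>\<^sup>+w. F w * (\<Prod>j\<in>J. V (w j)) \<partial>PiM I (\<lambda>_. G))"
    proof (rule nn_integral_coordinate_le[OF G sG V _ I(1) _ _ le])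
      show "(\<lambda>w. F w * (\<Prod>j\<in>J. V (w j))) \<in> borel_measurable (PiM I (\<lambda>_. G))"
        using F VJ by (intro borel_measurable_times_ennreal borel_measurable_prod_ennreal) auto
      fix w x y y'
      have "(\<Prod>j\<in>J. V ((w(a := (x, y))) j)) = (\<Prod>j\<in>J. V ((w(a := (x, y'))) j))"
        using insert.hyps by (intro prod.cong) auto
      then show "F (w(a := (x, y))) * (\<Prod>j\<in>J. V ((w(a := (x, y))) j)) =
          F (w(a := (x, y'))) * (\<Prod>j\<in>J. V ((w(a := (x, y'))) j))"
        using dep[of w a x y y'] by simp
    qed (use insert.prems in auto)
    also have "\<dots> \<le> c * (c ^ card J * (\<integral>\<^sup>+w. F w \<partial>PiM I (\<lambda>_. G)))"
      using insert by (intro mult_left_mono) auto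
    finally show ?case using insert.hyps by (simp add: mult.assoc)
  qed simp
qed

text \<open>
  The neighbours of \<open>x\<close> are chosen by looking at the covariates alone, so given the covariates the
  selected labels are still independent, each biased towards the side \<open>\<sigma>\<close> by at least \<open>\<delta>\<close> as long as its
  covariate lies in \<open>A\<close>. Hence the exponential moment is at most that of \<open>k\<close> independent labels
  with this bias.
\<close>

lemma nn_label_exp_moment:
  fixes G :: "('d::finite) pair measure"
  assumes G: "pair_distribution G" and \<eta>: "regression_function G \<eta>"
    and A: "A \<in> sets borel" and k: "k \<le> n" and s: "0 \<le> s" and \<sigma>: "\<bar>\<sigma>\<bar> = 1"
    and gap: "\<And>x. x \<in> A \<Longrightarrow> \<delta> \<le> \<sigma> * (\<eta> x - 1/2)"
  shows "(\<integral>\<^sup>+Z. indicator (k_nearest_in n k x A) Z *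
        ennreal (exp (- (s * \<sigma> * (\<Sum>j=1..k. nn_label n Z x j - 1/2)))) \<partial>PiM {..<n} (\<lambda>_. G))
      \<le> ennreal (exp (real k * (s\<^sup>2 / 8 - s * \<delta>)))"
proof -
  interpret prob_space G using G by (simp add: pair_distribution_def)
  have sG: "sets G = sets pair_space" using G by (simp add: pair_distribution_def)
  interpret S: prob_space "PiM {..<n} (\<lambda>_. G)" by (intro prob_space_PiM) unfold_locales
  note [measurable] = measurable_pair_projections[OF sG]
  note [measurable] = A measurable_nn_order_at[OF sG]
  have r\<eta>: "0 \<le> \<eta> y" "\<eta> y \<le> 1" for y using \<eta> by (auto simp: regression_function_def)
  define V :: "'d pair \<Rightarrow> ennreal" where
    "V z = indicator A (fst z) * ennreal (exp (- (s * \<sigma> * (label (snd z) - 1/2))))" for z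
  define c where "c = ennreal (exp (s\<^sup>2 / 8 - s * \<delta>))"
  have V[measurable]: "V \<in> borel_measurable G" unfolding V_def by measurable
  have V_le: "(\<integral>\<^sup>+z. u (fst z) * V z \<partial>G) \<le> c * (\<integral>\<^sup>+z. u (fst z) \<partial>G)"
    if u[measurable]: "u \<in> borel_measurable borel" for u :: "real^'d \<Rightarrow> ennreal"
  proof -
    have "(\<integral>\<^sup>+z. u (fst z) * V z \<partial>G) =
        (\<integral>\<^sup>+z. (u (fst z) * indicator A (fst z)) * ennreal (exp (- (s * \<sigma> * (label (snd z) - 1/2)))) \<partial>G)"
      by (simp add: V_def mult.assoc)
    also have "\<dots> = (\<integral>\<^sup>+z. u (fst z) * indicator A (fst z) *
        (ennreal (\<eta> (fst z)) * ennreal (exp (- (s * \<sigma> * (label True - 1/2)))) +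
         ennreal (1 - \<eta> (fst z)) * ennreal (exp (- (s * \<sigma> * (label False - 1/2))))) \<partial>G)"
      by (rule nn_integral_label[OF G \<eta>]) measurable
    also have "\<dots> \<le> (\<integral>\<^sup>+z. c * u (fst z) \<partial>G)"
    proof (rule nn_integral_mono)
      fix z :: "'d pair"
      show "u (fst z) * indicator A (fst z) *
        (ennreal (\<eta> (fst z)) * ennreal (exp (- (s * \<sigma> * (label True - 1/2)))) +
         ennreal (1 - \<eta> (fst z)) * ennreal (exp (- (s * \<sigma> * (label False - 1/2))))) \<le> c * u (fst z)"
      proof (cases "fst z \<in> A")
        case True
        have "\<eta> (fst z) * exp (- (s * \<sigma> * (label True - 1/2))) + (1 - \<eta> (fst z)) * exp (- (s * \<sigma> * (label False - 1/2)))
            \<le> exp ((s * \<sigma>)\<^sup>2 / 8 - s * \<sigma> * (\<eta> (fst z) - 1/2))"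
          using two_point_hoeffding[OF r\<eta>, of "fst z" "s * \<sigma>"] by (simp add: label_def)
        also have "\<dots> \<le> exp (s\<^sup>2 / 8 - s * \<delta>)"
        proof -
          have "\<sigma>\<^sup>2 = 1" using \<sigma> by (metis one_power2 power2_abs)
          then show ?thesis
            using mult_left_mono[OF gap[OF True] s] by (simp add: power_mult_distrib mult.assoc)
        qed
        finally have "ennreal (\<eta> (fst z)) * ennreal (exp (- (s * \<sigma> * (label True - 1/2)))) +
            ennreal (1 - \<eta> (fst z)) * ennreal (exp (- (s * \<sigma> * (label False - 1/2)))) \<le> c"
          unfolding c_def using r\<eta>[of "fst z"]
          by (simp add: ennreal_leI flip: ennreal_mult ennreal_plus)
        then show ?thesis using True
          by (simp add: mult.commute[of c] mult_left_mono)
      qed simp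
    qed
    also have "\<dots> = c * (\<integral>\<^sup>+z. u (fst z) \<partial>G)" by (rule nn_integral_cmult) measurable
    finally show ?thesis .
  qed
  \<comment> \<open>Which labels enter the sum depends on the covariates only, through the neighbour order; summing
    over the finitely many possible orders makes the selected indices constant.\<close>
  define Ls where "Ls = {L :: nat list. set L = {0..<n} \<and> length L = n}"
  have finLs: "finite Ls"
    by (rule finite_subset[OF _ finite_lists_length_eq[of "{0..<n}" n]]) (auto simp: Ls_def)
  have split: "indicator (k_nearest_in n k x A) Z * ennreal (exp (- (s * \<sigma> * (\<Sum>j=1..k. nn_label n Z x j - 1/2)))) =
      (\<Sum>L\<in>Ls. of_bool (nn_order n Z x = L) * (\<Prod>j\<in>set (take k L). V (Z j)))" for Z
  proof -
    let ?L = "nn_order n Z x"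
    have inj: "inj_on ((!) ?L) {..<k}"
      using k by (intro inj_on_nth) auto
    have st: "set (take k ?L) = (!) ?L ` {..<k}"
      using nth_image[of k ?L] k by (simp add: atLeast0LessThan)
    have "(\<Sum>L\<in>Ls. of_bool (?L = L) * (\<Prod>j\<in>set (take k L). V (Z j))) =
        (\<Sum>L\<in>Ls. if L = ?L then (\<Prod>j\<in>set (take k L). V (Z j)) else 0)"
      by (intro sum.cong) auto
    also have "\<dots> = (\<Prod>j\<in>set (take k ?L). V (Z j))"
      using finLs by (simp add: Ls_def)
    also have "\<dots> = (\<Prod>j<k. V (Z (?L ! j)))"
      unfolding st by (rule prod.reindex_cong[OF inj]) auto
    also have "\<dots> = (\<Prod>j<k. indicator A (fst (Z (?L ! j)))) *
        (\<Prod>j<k. ennreal (exp (- (s * \<sigma> * (label (snd (Z (?L ! j))) - 1/2)))))"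
      by (simp add: V_def prod.distrib)
    also have "(\<Prod>j<k. indicator A (fst (Z (?L ! j)))) = (indicator (k_nearest_in n k x A) Z :: ennreal)"
      by (auto simp: k_nearest_in_def indicator_def prod_zero_iff intro!: prod.neutral)
    also have "(\<Prod>j<k. ennreal (exp (- (s * \<sigma> * (label (snd (Z (?L ! j))) - 1/2))))) =
        ennreal (exp (\<Sum>j<k. - (s * \<sigma> * (label (snd (Z (?L ! j))) - 1/2))))"
      by (simp add: exp_sum prod_ennreal)
    also have "(\<Sum>j<k. - (s * \<sigma> * (label (snd (Z (?L ! j))) - 1/2))) =
        - (s * \<sigma> * (\<Sum>j=1..k. nn_label n Z x j - 1/2))"
    proof -
      have "(\<Sum>j=1..k. nn_label n Z x j - 1/2) = (\<Sum>j<k. label (snd (Z (?L ! j))) - 1/2)"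
        by (rule sum.reindex_bij_witness[of _ Suc "\<lambda>j. j - 1"]) (auto simp: nn_label_nn_order)
      then show ?thesis by (simp add: sum_distrib_left sum_negf)
    qed
    finally show ?thesis by simp
  qed
  have bound: "(\<integral>\<^sup>+Z. of_bool (nn_order n Z x = L) * (\<Prod>j\<in>set (take k L). V (Z j)) \<partial>PiM {..<n} (\<lambda>_. G))
      \<le> c ^ k * (\<integral>\<^sup>+Z. of_bool (nn_order n Z x = L) \<partial>PiM {..<n} (\<lambda>_. G))" if L: "L \<in> Ls" for L
  proof -
    have dL: "distinct L" using L by (auto simp: Ls_def intro!: card_distinct)
    have ck: "card (set (take k L)) = k"
      using dL L k by (subst distinct_card) (auto simp: Ls_def)
    have "(\<integral>\<^sup>+Z. of_bool (nn_order n Z x = L) * (\<Prod>j\<in>set (take k L). V (Z j)) \<partial>PiM {..<n} (\<lambda>_. G))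
      \<le> c ^ card (set (take k L)) * (\<integral>\<^sup>+Z. of_bool (nn_order n Z x = L) \<partial>PiM {..<n} (\<lambda>_. G))"
    proof (rule nn_integral_coordinates_le[OF prob_space_axioms sG V _ _ _ _ V_le])
      show "set (take k L) \<subseteq> {..<n}" using L set_take_subset[of k L] by (auto simp: Ls_def)
      fix w :: "nat \<Rightarrow> 'd pair" and a x' y y'
      have "(\<lambda>l. dist (fst ((w(a := (x', y))) l)) x) = (\<lambda>l. dist (fst ((w(a := (x', y'))) l)) x)"
        by auto
      then show "of_bool (nn_order n (w(a := (x', y))) x = L) =
          (of_bool (nn_order n (w(a := (x', y'))) x = L) :: ennreal)"
        by (simp add: nn_order_def)
    qed auto
    then show ?thesis by (simp add: ck)
  qed
  have Vm: "(\<lambda>Z. V (Z j)) \<in> borel_measurable (PiM {..<n} (\<lambda>_. G))" if "L \<in> Ls" "j \<in> set (take k L)" for L j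
  proof -
    have "j \<in> {..<n}" using that set_take_subset[of k L] by (auto simp: Ls_def)
    then show ?thesis by measurable
  qed
  have one: "(\<Sum>L\<in>Ls. of_bool (nn_order n Z x = L)) = (1::ennreal)" for Z
  proof -
    have "(\<Sum>L\<in>Ls. of_bool (nn_order n Z x = L)) = (\<Sum>L\<in>Ls. if L = nn_order n Z x then 1 else (0::ennreal))"
      by (intro sum.cong) auto
    then show ?thesis using finLs by (simp add: Ls_def)
  qed
  have "(\<integral>\<^sup>+Z. indicator (k_nearest_in n k x A) Z *
        ennreal (exp (- (s * \<sigma> * (\<Sum>j=1..k. nn_label n Z x j - 1/2)))) \<partial>PiM {..<n} (\<lambda>_. G)) =
      (\<Sum>L\<in>Ls. \<integral>\<^sup>+Z. of_bool (nn_order n Z x = L) * (\<Prod>j\<in>set (take k L). V (Z j)) \<partial>PiM {..<n} (\<lambda>_. G))"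
    unfolding split using Vm
    by (intro nn_integral_sum borel_measurable_times_ennreal borel_measurable_prod_ennreal) auto
  also have "\<dots> \<le> (\<Sum>L\<in>Ls. c ^ k * (\<integral>\<^sup>+Z. of_bool (nn_order n Z x = L) \<partial>PiM {..<n} (\<lambda>_. G)))"
    by (intro sum_mono bound)
  also have "\<dots> = c ^ k * (\<integral>\<^sup>+Z. (\<Sum>L\<in>Ls. of_bool (nn_order n Z x = L)) \<partial>PiM {..<n} (\<lambda>_. G))"
    by (subst nn_integral_sum) (auto simp: sum_distrib_left)
  also have "\<dots> = ennreal (exp (real k * (s\<^sup>2 / 8 - s * \<delta>)))"
    by (simp add: one c_def ennreal_power S.emeasure_space_1 flip: exp_of_nat_mult)
  finally show ?thesis .
qed

section \<open>Distances of nearest neighbours\<close>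

text \<open>
  If the neighbour at position \<open>j\<close>, counted from 0, has distance at least \<open>r\<close>, all points closer than \<open>r\<close>
  come before it.
\<close>

lemma few_near_points:
  assumes j: "j < n" and far: "r \<le> dist (fst (Z (nn_order n Z x ! j))) x"
  shows "card {l\<in>{..<n}. dist (fst (Z l)) x < r} \<le> j"
proof -
  let ?L = "nn_order n Z x"
  have "{l\<in>{..<n}. dist (fst (Z l)) x < r} \<subseteq> (!) ?L ` {..<j}"
  proof
    fix l assume l: "l \<in> {l\<in>{..<n}. dist (fst (Z l)) x < r}"
    then have "l \<in> set ?L" by simp
    then obtain i where i: "i < n" "?L ! i = l" by (metis in_set_conv_nth length_nn_order)
    have "i < j"
    proof (rule ccontr)
      assume "\<not> i < j"
      then have "dist (fst (Z (?L ! j))) x \<le> dist (fst (Z (?L ! i))) x"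
        using sorted_nth_mono[OF sorted_nn_order[of Z x n], of j i] i j by simp
      then show False using l i far by auto
    qed
    then show "l \<in> (!) ?L ` {..<j}" using i by auto
  qed
  then have "card {l\<in>{..<n}. dist (fst (Z l)) x < r} \<le> card ((!) ?L ` {..<j})"
    by (intro card_mono) auto
  also have "\<dots> \<le> j" using card_image_le[of "{..<j}" "(!) ?L"] by simp
  finally show ?thesis .
qed

text \<open>
  Up to a null event, the \<open>k\<close> nearest neighbours leave the ball only if fewer than \<open>k\<close> of the \<open>n\<close> points fall into it, a lower
  deviation of a binomial count of mean at least \<open>n * q\<close>.
\<close>

lemma k_nearest_in_ball_prob:
  fixes G :: "('d::finite) pair measure"
  assumes G: "pair_distribution G" and S: "AE z in G. fst z \<in> S"
    and A: "ball x r \<inter> S \<in> sets borel" and k: "k \<le> n"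
    and q: "q \<le> measure (marginal G) (ball x r)"
  shows "(\<integral>\<^sup>+Z. indicator (- k_nearest_in n k x (ball x r \<inter> S)) Z \<partial>PiM {..<n} (\<lambda>_. G))
      \<le> ennreal (exp (real k - real n * q / 2))"
proof -
  interpret prob_space G using G by (simp add: pair_distribution_def)
  have sG: "sets G = sets pair_space" using G by (simp add: pair_distribution_def)
  have spG: "space G = UNIV" by (rule space_pair_distribution[OF sG])
  interpret product_sigma_finite "\<lambda>_::nat. G" by unfold_locales
  note [measurable] = measurable_pair_projections(1)[OF sG]
  \<comment> \<open>Chernoff bound: fewer than k points in the ball makes this product, times exp k, at least 1.\<close>
  define v where "v z = exp (- of_bool (dist (fst z) x < r) :: real)" for z :: "'d pair"
  have [measurable]: "(\<lambda>z. ennreal (v z)) \<in> borel_measurable G" unfolding v_def by measurable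
  define B where "B = {z. dist (fst z) x < r} \<inter> space G"
  have [measurable]: "B \<in> sets G" unfolding B_def by measurable
  have B: "measure (marginal G) (ball x r) = prob B"
    unfolding marginal_def by (subst measure_distr) (auto simp: B_def dist_commute intro!: arg_cong[where f=prob])
  have "(\<integral>\<^sup>+z. ennreal (v z) \<partial>G) = (\<integral>\<^sup>+z. ennreal (exp (- 1)) * indicator B z + indicator (space G - B) z \<partial>G)"
    by (intro nn_integral_cong) (auto simp: v_def B_def indicator_def)
  also have "\<dots> = ennreal (exp (- 1)) * emeasure G B + emeasure G (space G - B)"
    by (subst nn_integral_add) (simp_all add: nn_integral_cmult)
  also have "\<dots> = ennreal (exp (- 1) * prob B + (1 - prob B))"
    by (simp add: emeasure_eq_measure prob_compl ennreal_mult)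
  also have "\<dots> \<le> ennreal (exp (- q / 2))"
  proof (rule ennreal_leI)
    have "exp (- 1 :: real) \<le> 1 / 2" using exp_ge_add_one_self[of 1] by (simp add: exp_minus field_simps)
    then have "exp (- 1) * prob B \<le> (1 / 2) * prob B" by (intro mult_right_mono) auto
    then have "exp (- 1) * prob B + (1 - prob B) \<le> 1 + - prob B / 2" by simp
    also have "\<dots> \<le> exp (- prob B / 2)" by (rule exp_ge_add_one_self)
    also have "\<dots> \<le> exp (- q / 2)" using q B by simp
    finally show "exp (- 1) * prob B + (1 - prob B) \<le> exp (- q / 2)" .
  qed
  finally have one: "(\<integral>\<^sup>+z. ennreal (v z) \<partial>G) \<le> ennreal (exp (- q / 2))" .
  have "AE Z in PiM {..<n} (\<lambda>_. G). \<forall>l\<in>{..<n}. fst (Z l) \<in> S"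
    by (intro AE_ball_countable' AE_PiM_component S prob_space_axioms) auto
  then have "AE Z in PiM {..<n} (\<lambda>_. G). indicator (- k_nearest_in n k x (ball x r \<inter> S)) Z
      \<le> ennreal (exp (real k)) * (\<Prod>l<n. ennreal (v (Z l)))"
  proof eventually_elim
    case (elim Z)
    show ?case
    proof (cases "Z \<in> k_nearest_in n k x (ball x r \<inter> S)")
      case False
      then obtain j where j: "j < k" "fst (Z (nn_order n Z x ! j)) \<notin> ball x r \<inter> S"
        by (auto simp: k_nearest_in_def)
      have "nn_order n Z x ! j \<in> set (nn_order n Z x)" using j k by (intro nth_mem) auto
      then have "fst (Z (nn_order n Z x ! j)) \<in> S" using elim by auto
      then have "r \<le> dist (fst (Z (nn_order n Z x ! j))) x" using j by (auto simp: dist_commute)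
      then have "card {l\<in>{..<n}. dist (fst (Z l)) x < r} \<le> j"
        using j k by (intro few_near_points) auto
      moreover have "(\<Sum>l<n. of_bool (dist (fst (Z l)) x < r)) = real (card {l\<in>{..<n}. dist (fst (Z l)) x < r})"
        by (simp add: of_bool_def sum.If_cases Int_def)
      ultimately have "0 \<le> real k + (\<Sum>l<n. - of_bool (dist (fst (Z l)) x < r))"
        using j by (simp add: sum_negf)
      then have "1 \<le> exp (real k + (\<Sum>l<n. - of_bool (dist (fst (Z l)) x < r)))" by simp
      also have "\<dots> = exp (real k) * (\<Prod>l<n. v (Z l))" by (simp add: exp_add exp_sum v_def)
      finally show ?thesis
        using False by (simp add: prod_ennreal v_def prod_nonneg flip: ennreal_mult)
    qed simp
  qed
  then have "(\<integral>\<^sup>+Z. indicator (- k_nearest_in n k x (ball x r \<inter> S)) Z \<partial>PiM {..<n} (\<lambda>_. G))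
      \<le> (\<integral>\<^sup>+Z. ennreal (exp (real k)) * (\<Prod>l<n. ennreal (v (Z l))) \<partial>PiM {..<n} (\<lambda>_. G))"
    by (rule nn_integral_mono_AE)
  also have "\<dots> = ennreal (exp (real k)) * (\<Prod>l<n. \<integral>\<^sup>+z. ennreal (v z) \<partial>G)"
  proof -
    have "(\<integral>\<^sup>+Z. (\<Prod>l<n. ennreal (v (Z l))) \<partial>PiM {..<n} (\<lambda>_. G)) = (\<Prod>l<n. \<integral>\<^sup>+z. ennreal (v z) \<partial>G)"
      by (rule product_nn_integral_prod) auto
    then show ?thesis
      by (subst nn_integral_cmult) (auto intro!: borel_measurable_prod_ennreal)
  qed
  also have "\<dots> \<le> ennreal (exp (real k)) * (\<Prod>l<n. ennreal (exp (- q / 2)))"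
    by (intro mult_left_mono prod_mono_ennreal one) auto
  also have "\<dots> = ennreal (exp (real k - real n * q / 2))"
  proof -
    have "exp (real k - real n * q / 2) = exp (real k + real n * (- q / 2))" by simp
    also have "\<dots> = exp (real k) * exp (- q / 2) ^ n" by (simp only: exp_add exp_of_nat_mult)
    finally show ?thesis by (simp only: prod_constant card_lessThan ennreal_power ennreal_mult' exp_ge_zero)
  qed
  finally show ?thesis .
qed

text \<open>
  Here \<open>u\<close> measures how much more mass the ball has than the \<open>k\<close> neighbours require. A sample with \<open>k = 0\<close>
  selects nothing and cannot fail; otherwise \<open>k \<ge> 1\<close>, which makes the bound uniform in the sample sizes.
\<close>

lemma far_prob:
  fixes G :: "('d::finite) pair measure"
  assumes G: "pair_distribution G" and S: "S = msupp (marginal G)"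
    and k: "k \<le> n" and q: "q \<le> measure (marginal G) (ball x r)"
    and u: "4 \<le> u" and nq: "u * real k \<le> real n * q"
  shows "(\<integral>\<^sup>+Z. indicator (- k_nearest_in n k x (ball x r \<inter> S)) Z \<partial>PiM {..<n} (\<lambda>_. G)) \<le> ennreal (exp (- u / 4))"
proof (cases "k = 0")
  case True
  then show ?thesis by (simp add: k_nearest_in_def)
next
  case False
  have "closed S" unfolding S by (rule closed_msupp_marginal[OF G])
  then have A: "ball x r \<inter> S \<in> sets borel" by auto
  have "(\<integral>\<^sup>+Z. indicator (- k_nearest_in n k x (ball x r \<inter> S)) Z \<partial>PiM {..<n} (\<lambda>_. G)) \<le>
      ennreal (exp (real k - real n * q / 2))"
    by (rule k_nearest_in_ball_prob[OF G _ A k q]) (simp add: S AE_msupp_marginal[OF G])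
  also have "\<dots> \<le> ennreal (exp (- u / 4))"
  proof (intro ennreal_leI iffD2[OF exp_le_cancel_iff])
    have "1 * (u / 4) \<le> real k * (u / 4)" using False u by (intro mult_right_mono) auto
    moreover have "real k * 4 \<le> real k * u" using u by (intro mult_left_mono) auto
    ultimately show "real k - real n * q / 2 \<le> - u / 4" using nq by (simp add: mult.commute)
  qed
  finally show ?thesis .
qed

text \<open>
  Only the part of the ball inside the support is known to have density at least \<open>lo\<close>; regularity of the
  support bounds its volume from below.
\<close>

lemma ball_mass:
  fixes G :: "('d::finite) pair measure"
  assumes G: "pair_distribution G" and dens: "density_between lo hi S G"
    and reg: "regular_set c r0 S" and S: "closed S" and x: "x \<in> S"
    and r: "0 < r" "r \<le> r0" and lo: "0 \<le> lo"
  shows "lo * c * unit_ball_vol (real CARD('d)) * r ^ CARD('d) \<le> measure (marginal G) (ball x r)"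
proof -
  interpret prob_space G using G by (simp add: pair_distribution_def)
  have sG: "sets G = sets pair_space" using G by (simp add: pair_distribution_def)
  note [measurable] = measurable_pair_projections(1)[OF sG]
  interpret X: prob_space "marginal G" by (rule prob_space_marginal[OF G])
  obtain p where p: "distributed G lborel fst (\<lambda>x. ennreal (p x))" "\<And>y. y \<in> S \<Longrightarrow> lo < p y"
    using dens by (auto simp: density_between_def)
  have pm[measurable]: "(\<lambda>x. ennreal (p x)) \<in> borel_measurable borel"
    using distributed_borel_measurable[OF p(1)] by simp
  have "marginal G = distr G lborel fst" unfolding marginal_def by (intro distr_cong) auto
  then have marg: "marginal G = density lborel (\<lambda>x. ennreal (p x))"
    using distributed_distr_eq_density[OF p(1)] by simp
  have SB[measurable]: "S \<inter> ball x r \<in> sets borel" using S by auto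
  have fin: "emeasure lborel (S \<inter> ball x r) < \<infinity>"
  proof -
    have "emeasure lborel (S \<inter> ball x r) \<le> emeasure lborel (ball x r)"
      by (rule emeasure_mono) auto
    also have "\<dots> < \<infinity>" by (rule emeasure_lborel_ball_finite)
    finally show ?thesis .
  qed
  have em: "emeasure lborel (S \<inter> ball x r) = ennreal (measure lborel (S \<inter> ball x r))"
    by (rule emeasure_eq_ennreal_measure) (use fin in \<open>simp add: less_top[symmetric]\<close>)
  have "ennreal (lo * measure lborel (S \<inter> ball x r)) = (\<integral>\<^sup>+y. ennreal lo * indicator (S \<inter> ball x r) y \<partial>lborel)"
    by (subst nn_integral_cmult_indicator) (simp_all only: em SB sets_lborel ennreal_mult lo measure_nonneg)
  also have "\<dots> \<le> (\<integral>\<^sup>+y. ennreal (p y) * indicator (S \<inter> ball x r) y \<partial>lborel)"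
    by (intro nn_integral_mono) (auto simp: indicator_def intro!: ennreal_leI less_imp_le[OF p(2)])
  also have "\<dots> = emeasure (marginal G) (S \<inter> ball x r)"
    unfolding marg by (subst emeasure_density) auto
  also have "\<dots> \<le> emeasure (marginal G) (ball x r)"
    by (intro emeasure_mono) (auto simp: marginal_def)
  finally have "ennreal (lo * measure lborel (S \<inter> ball x r)) \<le> ennreal (measure (marginal G) (ball x r))"
    unfolding X.emeasure_eq_measure .
  then have "lo * measure lborel (S \<inter> ball x r) \<le> measure (marginal G) (ball x r)"
    by (subst (asm) ennreal_le_iff) auto
  moreover have "c * measure lborel (ball x r) \<le> measure lborel (S \<inter> ball x r)"
    using reg x r by (auto simp: regular_set_def)
  moreover have "measure lborel (ball x r) = unit_ball_vol (real CARD('d)) * r ^ CARD('d)"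
    using content_ball[of r x] r by simp
  ultimately have "lo * (c * (unit_ball_vol (real CARD('d)) * r ^ CARD('d))) \<le> measure (marginal G) (ball x r)"
    using lo by (auto intro: order_trans[OF mult_left_mono])
  then show ?thesis by (simp add: mult.assoc)
qed

section \<open>The weighted vote\<close>

text \<open>
  Fubini in the form needed for a union bound over the samples combined with a product of moment
  factors.
\<close>

lemma nn_integral_independent_samples:
  fixes N :: "'i \<Rightarrow> 'a measure" and M :: "'b measure"
  assumes N: "\<And>i. prob_space (N i)" and M: "prob_space M" and I: "finite I"
    and [measurable]: "\<And>i. i \<in> I \<Longrightarrow> b i \<in> borel_measurable (N i)" "b' \<in> borel_measurable M"
      "\<And>i. i \<in> I \<Longrightarrow> g i \<in> borel_measurable (N i)" "g' \<in> borel_measurable M"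
  shows "(\<integral>\<^sup>+Z. (\<Sum>i\<in>I. b i (fst Z i)) + b' (snd Z) + g' (snd Z) * (\<Prod>i\<in>I. g i (fst Z i)) \<partial>(PiM I N \<Otimes>\<^sub>M M)) =
    (\<Sum>i\<in>I. \<integral>\<^sup>+z. b i z \<partial>N i) + (\<integral>\<^sup>+z. b' z \<partial>M) + (\<integral>\<^sup>+z. g' z \<partial>M) * (\<Prod>i\<in>I. \<integral>\<^sup>+z. g i z \<partial>N i)"
proof -
  interpret M: prob_space M by fact
  interpret N: prob_space "N i" for i by fact
  interpret P: product_sigma_finite N by unfold_locales
  interpret PN: prob_space "PiM I N" by (rule prob_space_PiM) (rule N)
  have bI: "(\<lambda>Z. b i (Z i)) \<in> borel_measurable (PiM I N)"
    and gI: "(\<lambda>Z. g i (Z i)) \<in> borel_measurable (PiM I N)" if "i \<in> I" for i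
    using that by measurable
  have gP[measurable]: "(\<lambda>Z. \<Prod>i\<in>I. g i (Z i)) \<in> borel_measurable (PiM I N)"
    using gI by (intro borel_measurable_prod_ennreal) auto
  have comp: "(\<integral>\<^sup>+Z. b i (Z i) \<partial>PiM I N) = (\<integral>\<^sup>+z. b i z \<partial>N i)" if "i \<in> I" for i
  proof -
    have "(\<integral>\<^sup>+z. b i z \<partial>N i) = (\<integral>\<^sup>+z. b i z \<partial>distr (PiM I N) (N i) (\<lambda>Z. Z i))"
      using distr_PiM_component[of I N i] N I that by simp
    also have "\<dots> = (\<integral>\<^sup>+Z. b i (Z i) \<partial>PiM I N)"
      using that by (subst nn_integral_distr) auto
    finally show ?thesis by simp
  qed
  have [measurable]: "(\<lambda>Z. \<Sum>i\<in>I. b i (fst Z i)) \<in> borel_measurable (PiM I N \<Otimes>\<^sub>M M)"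
    using measurable_compose[OF measurable_fst bI] by (intro borel_measurable_sum) auto
  have [measurable]: "(\<lambda>Z. \<Prod>i\<in>I. g i (fst Z i)) \<in> borel_measurable (PiM I N \<Otimes>\<^sub>M M)"
    using measurable_compose[OF measurable_fst gP] by auto
  have 1: "(\<integral>\<^sup>+Z. (\<Sum>i\<in>I. b i (fst Z i)) \<partial>(PiM I N \<Otimes>\<^sub>M M)) = (\<Sum>i\<in>I. \<integral>\<^sup>+z. b i z \<partial>N i)"
  proof -
    have "(\<integral>\<^sup>+Z. (\<Sum>i\<in>I. b i (fst Z i)) \<partial>(PiM I N \<Otimes>\<^sub>M M)) = (\<integral>\<^sup>+Z. (\<Sum>i\<in>I. b i (Z i)) \<partial>PiM I N)"
      by (subst M.nn_integral_fst[symmetric]) (simp_all add: M.emeasure_space_1)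
    also have "\<dots> = (\<Sum>i\<in>I. \<integral>\<^sup>+Z. b i (Z i) \<partial>PiM I N)"
      using bI by (rule nn_integral_sum)
    finally show ?thesis using comp by simp
  qed
  have 2: "(\<integral>\<^sup>+Z. b' (snd Z) \<partial>(PiM I N \<Otimes>\<^sub>M M)) = (\<integral>\<^sup>+z. b' z \<partial>M)"
    by (subst M.nn_integral_fst[symmetric]) (simp_all add: PN.emeasure_space_1)
  have 3: "(\<integral>\<^sup>+Z. g' (snd Z) * (\<Prod>i\<in>I. g i (fst Z i)) \<partial>(PiM I N \<Otimes>\<^sub>M M)) =
      (\<integral>\<^sup>+z. g' z \<partial>M) * (\<Prod>i\<in>I. \<integral>\<^sup>+z. g i z \<partial>N i)"
  proof -
    have "(\<integral>\<^sup>+Z. g' (snd Z) * (\<Prod>i\<in>I. g i (fst Z i)) \<partial>(PiM I N \<Otimes>\<^sub>M M)) =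
        (\<integral>\<^sup>+Z. (\<integral>\<^sup>+z. g' z \<partial>M) * (\<Prod>i\<in>I. g i (Z i)) \<partial>PiM I N)"
      by (subst M.nn_integral_fst[symmetric]) (simp_all add: nn_integral_multc)
    also have "\<dots> = (\<integral>\<^sup>+z. g' z \<partial>M) * (\<integral>\<^sup>+Z. (\<Prod>i\<in>I. g i (Z i)) \<partial>PiM I N)"
      by (rule nn_integral_cmult) measurable
    also have "(\<integral>\<^sup>+Z. (\<Prod>i\<in>I. g i (Z i)) \<partial>PiM I N) = (\<Prod>i\<in>I. \<integral>\<^sup>+z. g i z \<partial>N i)"
      using I by (rule P.product_nn_integral_prod) auto
    finally show ?thesis .
  qed
  show ?thesis by (subst nn_integral_add, simp, simp, subst nn_integral_add) (simp_all add: 1 2 3)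
qed

text \<open>
  Half the denominator of the estimate is subtracted here from its numerator, so that the classifier
  is decided by the sign and the empty case, with value 0, needs no separate treatment.
\<close>

definition vote ::
    "nat \<Rightarrow> (nat \<Rightarrow> nat) \<Rightarrow> nat \<Rightarrow> (nat \<Rightarrow> nat) \<Rightarrow> nat \<Rightarrow> (nat \<Rightarrow> real) \<Rightarrow> real \<Rightarrow>
     ('d::finite) data \<Rightarrow> real^'d \<Rightarrow> real" where
  "vote m nP nQ kP kQ wP wQ Z x =
     wQ * (\<Sum>j=1..kQ. nn_label nQ (snd Z) x j - 1/2) +
     (\<Sum>i=1..m. wP i * (\<Sum>j=1..kP i. nn_label (nP i) (fst Z i) x j - 1/2))"

text \<open>
  With \<open>\<tau> = knn_weight d \<beta> N 1\<close>, the accuracy at which \<open>\<eta>Q\<close> can be resolved, the weight for transfer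
  exponent \<open>g\<close> is \<open>\<tau> powr g\<close>: the strength that a target signal of size \<open>\<tau>\<close> has in that source.
\<close>

definition knn_weight :: "nat \<Rightarrow> real \<Rightarrow> real \<Rightarrow> real \<Rightarrow> real" where
  "knn_weight d \<beta> N g = N powr (- (g * \<beta> / (2 * \<beta> + real d)))"

definition knn_count :: "nat \<Rightarrow> real \<Rightarrow> real \<Rightarrow> nat \<Rightarrow> nat" where
  "knn_count d \<beta> N n = nat \<lfloor>real n * N powr (- (real d / (2 * \<beta> + real d)))\<rfloor>"

lemma knn_classifier_iff_vote:
  fixes Z :: "('d::finite) data" and m :: nat and \<beta> :: real and \<gamma> :: "nat \<Rightarrow> real"
    and nP :: "nat \<Rightarrow> nat" and nQ :: nat
  defines "N \<equiv> effective_size CARD('d) m \<beta> \<gamma> nP nQ"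
  assumes N: "N > 0"
  shows "knn_classifier m \<beta> \<gamma> nP nQ Z x \<longleftrightarrow>
    0 < vote m nP nQ (\<lambda>i. knn_count CARD('d) \<beta> N (nP i)) (knn_count CARD('d) \<beta> N nQ)
          (\<lambda>i. knn_weight CARD('d) \<beta> N (\<gamma> i)) (knn_weight CARD('d) \<beta> N 1) Z x"
proof -
  define wP where "wP i = knn_weight CARD('d) \<beta> N (\<gamma> i)" for i
  define wQ where "wQ = knn_weight CARD('d) \<beta> N 1"
  define kP where "kP i = knn_count CARD('d) \<beta> N (nP i)" for i
  define kQ where "kQ = knn_count CARD('d) \<beta> N nQ"
  have w: "wQ > 0" "wP i > 0" for i using N by (simp_all add: wQ_def wP_def knn_weight_def)
  define S where "S = wQ * (\<Sum>j=1..kQ. nn_label nQ (snd Z) x j) + (\<Sum>i=1..m. wP i * (\<Sum>j=1..kP i. nn_label (nP i) (fst Z i) x j))"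
  define W where "W = wQ * real kQ + (\<Sum>i=1..m. wP i * real (kP i))"
  have est: "knn_estimate m \<beta> \<gamma> nP nQ Z x = (if kQ = 0 \<and> (\<forall>i\<in>{1..m}. kP i = 0) then 1/2 else S / W)"
    by (simp add: knn_estimate_def Let_def S_def W_def wQ_def wP_def kQ_def kP_def knn_weight_def knn_count_def N_def)
  have vote: "vote m nP nQ kP kQ wP wQ Z x = S - W / 2"
    by (simp add: vote_def S_def W_def sum_subtractf algebra_simps sum.distrib sum_divide_distrib add_divide_distrib)
  have "knn_classifier m \<beta> \<gamma> nP nQ Z x \<longleftrightarrow> 0 < S - W / 2"
  proof (cases "kQ = 0 \<and> (\<forall>i\<in>{1..m}. kP i = 0)")
    case True
    then show ?thesis by (simp add: knn_classifier_def est S_def W_def)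
  next
    case False
    have nonneg: "0 \<le> wQ * real kQ" "0 \<le> (\<Sum>i=1..m. wP i * real (kP i))"
      using w by (auto intro!: sum_nonneg mult_nonneg_nonneg simp: less_imp_le)
    have "W > 0"
    proof (cases "kQ = 0")
      case True
      then obtain i where i: "i \<in> {1..m}" "kP i \<noteq> 0" using False by auto
      have "0 < wP i * real (kP i)" using i w by simp
      also have "\<dots> \<le> (\<Sum>i=1..m. wP i * real (kP i))"
        using i w by (intro member_le_sum) (auto simp: less_imp_le)
      finally show ?thesis using nonneg by (simp add: W_def)
    qed (use nonneg w in \<open>auto simp: W_def intro!: add_pos_nonneg\<close>)
    moreover have "knn_estimate m \<beta> \<gamma> nP nQ Z x = S / W"
      by (simp only: est False if_False)
    ultimately have "knn_classifier m \<beta> \<gamma> nP nQ Z x \<longleftrightarrow> 1/2 < S / W"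
      by (simp add: knn_classifier_def)
    also have "\<dots> \<longleftrightarrow> 0 < S - W / 2" using \<open>W > 0\<close> by (simp add: field_simps)
    finally show ?thesis .
  qed
  then show ?thesis using vote by (simp add: wP_def[abs_def] wQ_def kP_def[abs_def] kQ_def)
qed

lemma measurable_vote:
  fixes P :: "nat \<Rightarrow> ('d::finite) pair measure"
  assumes P: "\<And>i. sets (P i) = sets pair_space" and Q: "sets Q = sets pair_space"
  shows "(\<lambda>(Z, x). vote m nP nQ kP kQ wP wQ Z x) \<in> borel_measurable (data_measure m nP nQ P Q \<Otimes>\<^sub>M borel)"
proof -
  let ?D = "data_measure m nP nQ P Q"
  have Qm[measurable]: "(\<lambda>p. nn_label nQ (snd (fst p)) (snd p) j) \<in> borel_measurable (?D \<Otimes>\<^sub>M borel)" for j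
  proof -
    have "(\<lambda>p. (snd (fst p), snd p)) \<in> measurable (?D \<Otimes>\<^sub>M borel) (PiM {..<nQ} (\<lambda>_. Q) \<Otimes>\<^sub>M borel)"
      unfolding data_measure_def by measurable
    from measurable_compose[OF this measurable_nn_label[OF Q]] show ?thesis by simp
  qed
  have Pm[measurable]: "(\<lambda>p. nn_label (nP i) (fst (fst p) i) (snd p) j) \<in> borel_measurable (?D \<Otimes>\<^sub>M borel)"
    if i: "i \<in> {1..m}" for i j
  proof -
    have "(\<lambda>p. (fst (fst p) i, snd p)) \<in> measurable (?D \<Otimes>\<^sub>M borel) (PiM {..<nP i} (\<lambda>_. P i) \<Otimes>\<^sub>M borel)"
      unfolding data_measure_def using i by measurable
    from measurable_compose[OF this measurable_nn_label[OF P]] show ?thesis by simp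
  qed
  show ?thesis
    unfolding vote_def split_beta
    by (intro borel_measurable_add borel_measurable_times borel_measurable_sum borel_measurable_diff
        borel_measurable_const Qm Pm)
qed

lemma measurable_knn_classifier:
  fixes P :: "nat \<Rightarrow> ('d::finite) pair measure"
  assumes P: "\<And>i. sets (P i) = sets pair_space" and Q: "sets Q = sets pair_space"
    and N: "0 < effective_size CARD('d) m \<beta> \<gamma> nP nQ"
  shows "Measurable.pred (data_measure m nP nQ P Q \<Otimes>\<^sub>M borel) (\<lambda>(Z, x). knn_classifier m \<beta> \<gamma> nP nQ Z x)"
proof -
  show ?thesis
    unfolding knn_classifier_iff_vote[OF N] split_beta
    using measurable_vote[OF P Q] unfolding split_beta by (rule borel_measurable_less[OF borel_measurable_const, unfolded pred_def[symmetric]])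
qed

lemma pred_knn_classifier:
  fixes P :: "nat \<Rightarrow> ('d::finite) pair measure"
  assumes P: "\<And>i. sets (P i) = sets pair_space" and Q: "sets Q = sets pair_space"
    and N: "0 < effective_size CARD('d) m \<beta> \<gamma> nP nQ" and Z: "Z \<in> space (data_measure m nP nQ P Q)"
  shows "Measurable.pred borel (knn_classifier m \<beta> \<gamma> nP nQ Z)"
  using measurable_compose[OF measurable_Pair1'[OF Z] measurable_knn_classifier[OF P Q N]] by simp

text \<open>
  Either some sample has one of its selected neighbours outside \<open>A\<close>, which the union bound pays for, or
  all selected labels are biased towards the side \<open>\<sigma>\<close> and Markov's inequality applies to the
  exponential of \<open>- (l * \<sigma>)\<close> times the vote, which factorizes over the independent samples.
\<close>

lemma weighted_vote_error:
  fixes P :: "nat \<Rightarrow> ('d::finite) pair measure"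
  assumes P: "\<And>i. pair_distribution (P i)" "\<And>i. i \<in> {1..m} \<Longrightarrow> regression_function (P i) (\<eta>P i)"
    and Q: "pair_distribution Q" "regression_function Q \<eta>Q"
    and A: "A \<in> sets borel"
    and k: "\<And>i. i \<in> {1..m} \<Longrightarrow> kP i \<le> nP i" "kQ \<le> nQ"
    and w: "\<And>i. 0 \<le> wP i" "0 \<le> wQ" and l: "0 \<le> l" and \<sigma>: "\<bar>\<sigma>\<bar> = 1"
    and gapP: "\<And>i y. i \<in> {1..m} \<Longrightarrow> y \<in> A \<Longrightarrow> \<delta>P i \<le> \<sigma> * (\<eta>P i y - 1/2)"
    and gapQ: "\<And>y. y \<in> A \<Longrightarrow> \<delta>Q \<le> \<sigma> * (\<eta>Q y - 1/2)"
    and farP: "\<And>i. i \<in> {1..m} \<Longrightarrow>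
        (\<integral>\<^sup>+Z. indicator (- k_nearest_in (nP i) (kP i) x A) Z \<partial>PiM {..<nP i} (\<lambda>_. P i)) \<le> ennreal b"
    and farQ: "(\<integral>\<^sup>+Z. indicator (- k_nearest_in nQ kQ x A) Z \<partial>PiM {..<nQ} (\<lambda>_. Q)) \<le> ennreal b"
    and b: "0 \<le> b"
  shows "(\<integral>\<^sup>+Z. of_bool (\<sigma> * vote m nP nQ kP kQ wP wQ Z x \<le> 0) \<partial>data_measure m nP nQ P Q)
    \<le> ennreal (real (m + 1) * b +
        exp (real kQ * ((l * wQ)\<^sup>2 / 8 - l * wQ * \<delta>Q) +
             (\<Sum>i=1..m. real (kP i) * ((l * wP i)\<^sup>2 / 8 - l * wP i * \<delta>P i))))"
proof -
  define I where "I = {1..m}"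
  define N where "N i = PiM {..<nP i} (\<lambda>_. P i)" for i
  define M where "M = PiM {..<nQ} (\<lambda>_. Q)"
  have sP: "sets (P i) = sets pair_space" and sQ: "sets Q = sets pair_space" for i
    using P Q by (auto simp: pair_distribution_def)
  have pN: "prob_space (N i)" and pM: "prob_space M" for i
    using P Q by (auto simp: N_def M_def pair_distribution_def intro!: prob_space_PiM)
  define S where "S n k Z = (\<Sum>j=1..k. nn_label n Z x j - 1/2)" for n k Z
  define bP :: "nat \<Rightarrow> (nat \<Rightarrow> 'd pair) \<Rightarrow> ennreal" where "bP i = indicator (- k_nearest_in (nP i) (kP i) x A)" for i
  define bQ :: "(nat \<Rightarrow> 'd pair) \<Rightarrow> ennreal" where "bQ = indicator (- k_nearest_in nQ kQ x A)"
  define gP where "gP i Z = indicator (k_nearest_in (nP i) (kP i) x A) Z * ennreal (exp (- (l * wP i * \<sigma> * S (nP i) (kP i) Z)))" for i Z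
  define gQ where "gQ Z = indicator (k_nearest_in nQ kQ x A) Z * ennreal (exp (- (l * wQ * \<sigma> * S nQ kQ Z)))" for Z
  have ind: "(\<lambda>Z. indicator (k_nearest_in n k x A) Z) \<in> borel_measurable (PiM {..<n} (\<lambda>_. G))"
    "(\<lambda>Z. indicator (- k_nearest_in n k x A) Z) \<in> borel_measurable (PiM {..<n} (\<lambda>_. G))"
    if "sets G = sets pair_space" for n k and G :: "'d pair measure"
    using pred_k_nearest_in[OF that A, of n k x]
    by (simp_all add: borel_measurable_indicator_iff pred_def)
  have S: "(\<lambda>Z. S n k Z) \<in> borel_measurable (PiM {..<n} (\<lambda>_. G))"
    if "sets G = sets pair_space" for n k and G :: "'d pair measure"
    unfolding S_def using measurable_nn_label_at[OF that, of n x]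
    by (intro borel_measurable_sum borel_measurable_diff) auto
  note [measurable] = ind[OF sP] ind[OF sQ] S[OF sP] S[OF sQ]
  have vote: "vote m nP nQ kP kQ wP wQ Z x = wQ * S nQ kQ (snd Z) + (\<Sum>i\<in>I. wP i * S (nP i) (kP i) (fst Z i))" for Z
    by (simp add: vote_def S_def I_def)
  have pointwise: "of_bool (\<sigma> * vote m nP nQ kP kQ wP wQ Z x \<le> 0) \<le>
      (\<Sum>i\<in>I. bP i (fst Z i)) + bQ (snd Z) + gQ (snd Z) * (\<Prod>i\<in>I. gP i (fst Z i))" for Z
  proof (cases "snd Z \<in> k_nearest_in nQ kQ x A \<and> (\<forall>i\<in>I. fst Z i \<in> k_nearest_in (nP i) (kP i) x A)")
    case True
    then have "gQ (snd Z) * (\<Prod>i\<in>I. gP i (fst Z i)) =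
        ennreal (exp (- (l * wQ * \<sigma> * S nQ kQ (snd Z))) * (\<Prod>i\<in>I. exp (- (l * wP i * \<sigma> * S (nP i) (kP i) (fst Z i)))))"
      by (simp add: gP_def gQ_def prod_ennreal ennreal_mult prod_nonneg)
    also have "exp (- (l * wQ * \<sigma> * S nQ kQ (snd Z))) * (\<Prod>i\<in>I. exp (- (l * wP i * \<sigma> * S (nP i) (kP i) (fst Z i)))) =
        exp (- (l * (\<sigma> * vote m nP nQ kP kQ wP wQ Z x)))"
      by (simp add: vote I_def exp_add[symmetric] exp_sum[symmetric] sum_negf sum_distrib_left algebra_simps)
    finally have eq: "gQ (snd Z) * (\<Prod>i\<in>I. gP i (fst Z i)) = ennreal (exp (- (l * (\<sigma> * vote m nP nQ kP kQ wP wQ Z x))))" .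
    show ?thesis
    proof (cases "\<sigma> * vote m nP nQ kP kQ wP wQ Z x \<le> 0")
      case True
      then have "1 \<le> exp (- (l * (\<sigma> * vote m nP nQ kP kQ wP wQ Z x)))"
        using l by (simp add: mult_nonneg_nonpos)
      then have "1 \<le> gQ (snd Z) * (\<Prod>i\<in>I. gP i (fst Z i))" by (simp add: eq)
      then show ?thesis using True by (simp add: add_increasing)
    qed simp
  next
    case False
    then have "1 \<le> (\<Sum>i\<in>I. bP i (fst Z i)) + bQ (snd Z)"
    proof (cases "snd Z \<in> k_nearest_in nQ kQ x A")
      case True
      then obtain i where i: "i \<in> I" "fst Z i \<notin> k_nearest_in (nP i) (kP i) x A" using False by auto
      then have "1 = bP i (fst Z i)" by (simp add: bP_def)
      also have "\<dots> \<le> (\<Sum>i\<in>I. bP i (fst Z i))" using i by (intro member_le_sum) (auto simp: I_def)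
      finally show ?thesis by (simp add: add_increasing2)
    qed (simp add: bQ_def add_increasing)
    then show ?thesis by (simp add: add_increasing2 order_trans[OF of_bool_less_eq_iff[THEN iffD2]])
  qed
  have "(\<integral>\<^sup>+Z. of_bool (\<sigma> * vote m nP nQ kP kQ wP wQ Z x \<le> 0) \<partial>data_measure m nP nQ P Q) \<le>
      (\<integral>\<^sup>+Z. (\<Sum>i\<in>I. bP i (fst Z i)) + bQ (snd Z) + gQ (snd Z) * (\<Prod>i\<in>I. gP i (fst Z i)) \<partial>(PiM I N \<Otimes>\<^sub>M M))"
    unfolding data_measure_def N_def M_def I_def[symmetric] by (intro nn_integral_mono pointwise)
  also have "\<dots> = (\<Sum>i\<in>I. \<integral>\<^sup>+z. bP i z \<partial>N i) + (\<integral>\<^sup>+z. bQ z \<partial>M) + (\<integral>\<^sup>+z. gQ z \<partial>M) * (\<Prod>i\<in>I. \<integral>\<^sup>+z. gP i z \<partial>N i)"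
    by (rule nn_integral_independent_samples[OF pN pM]) (simp_all add: I_def bP_def bQ_def gP_def[abs_def] gQ_def[abs_def] N_def M_def)
  also have "\<dots> \<le> (\<Sum>i\<in>I. ennreal b) + ennreal b +
      ennreal (exp (real kQ * ((l * wQ)\<^sup>2 / 8 - l * wQ * \<delta>Q))) *
      (\<Prod>i\<in>I. ennreal (exp (real (kP i) * ((l * wP i)\<^sup>2 / 8 - l * wP i * \<delta>P i))))"
  proof (intro add_mono mult_mono sum_mono prod_mono_ennreal)
    show "(\<integral>\<^sup>+z. bQ z \<partial>M) \<le> ennreal b" using farQ by (simp add: bQ_def M_def)
    show "(\<integral>\<^sup>+z. gQ z \<partial>M) \<le> ennreal (exp (real kQ * ((l * wQ)\<^sup>2 / 8 - l * wQ * \<delta>Q)))"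
      unfolding gQ_def M_def S_def using l w k
      by (intro nn_label_exp_moment[OF Q A _ _ \<sigma> gapQ]) auto
    fix i assume i: "i \<in> I"
    show "(\<integral>\<^sup>+z. bP i z \<partial>N i) \<le> ennreal b" using farP[of i] i by (simp add: bP_def N_def I_def)
    show "(\<integral>\<^sup>+z. gP i z \<partial>N i) \<le> ennreal (exp (real (kP i) * ((l * wP i)\<^sup>2 / 8 - l * wP i * \<delta>P i)))"
      unfolding gP_def N_def S_def using l w k i
      by (intro nn_label_exp_moment[OF P(1) P(2) A _ _ \<sigma> gapP]) (auto simp: I_def)
  qed auto
  also have "\<dots> = ennreal (real (m + 1) * b +
        exp (real kQ * ((l * wQ)\<^sup>2 / 8 - l * wQ * \<delta>Q) +
             (\<Sum>i=1..m. real (kP i) * ((l * wP i)\<^sup>2 / 8 - l * wP i * \<delta>P i))))"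
  proof -
    have "(\<Sum>i\<in>I. ennreal b) + ennreal b = ennreal (real (m + 1) * b)"
      using b by (simp add: I_def ennreal_of_nat_eq_real_of_nat algebra_simps flip: ennreal_mult ennreal_plus)
    moreover have "ennreal (exp u) * (\<Prod>i\<in>I. ennreal (exp (v i))) = ennreal (exp (u + (\<Sum>i=1..m. v i)))" for u v
      by (simp add: I_def prod_ennreal exp_add exp_sum prod_nonneg flip: ennreal_mult)
    ultimately show ?thesis using b by (simp only: ennreal_plus mult_nonneg_nonneg of_nat_0_le_iff exp_ge_zero)
  qed
  finally show ?thesis .
qed

section \<open>Weights and the effective sample size\<close>

lemma finite_positive_lower_bound:
  fixes f :: "'a \<Rightarrow> real"
  assumes "finite I" and "\<And>i. i \<in> I \<Longrightarrow> 0 < f i" and "0 < u"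
  obtains c where "0 < c" "c \<le> u" "\<And>i. i \<in> I \<Longrightarrow> c \<le> f i"
proof
  show "0 < Min (insert u (f ` I))" using assms by (subst Min_gr_iff) auto
  show "Min (insert u (f ` I)) \<le> u" using assms by (intro Min_le) auto
  show "Min (insert u (f ` I)) \<le> f i" if "i \<in> I" for i using assms that by (intro Min_le) auto
qed

lemma knn_count_le:
  assumes "1 \<le> N" "0 < \<beta>"
  shows "real (knn_count d \<beta> N n) \<le> real n * N powr (- (real d / (2 * \<beta> + real d)))"
    and "knn_count d \<beta> N n \<le> n"
proof -
  have "0 \<le> real n * N powr (- (real d / (2 * \<beta> + real d)))" by simp
  then show 1: "real (knn_count d \<beta> N n) \<le> real n * N powr (- (real d / (2 * \<beta> + real d)))"
    unfolding knn_count_def by linarith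
  have "N powr (- (real d / (2 * \<beta> + real d))) \<le> N powr 0"
    using assms by (intro powr_mono) auto
  then have "real n * N powr (- (real d / (2 * \<beta> + real d))) \<le> real n * 1"
    using assms by (intro mult_left_mono) auto
  then show "knn_count d \<beta> N n \<le> n" using 1 by linarith
qed

text \<open>
  The variance proxy \<open>w\<^sup>2 * k\<close> of a source is about \<open>n\<close> divided by a power of \<open>N\<close>, and the exponents in
  the effective size are exactly those for which it has order 1 as soon as the source contributes a
  fixed fraction of \<open>N\<close>.
\<close>

lemma source_signal:
  assumes \<beta>: "0 < \<beta>" and d: "0 < d" and g: "0 < g" and M: "1 \<le> M"
    and n: "N / M \<le> real n powr ((2 * \<beta> + real d) / (2 * g * \<beta> + real d))"
    and N: "M powr ((2 * g * \<beta> + real d) / (2 * g * \<beta>)) \<le> N"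
  shows "M powr (- ((2 * g * \<beta> + real d) / (2 * \<beta> + real d))) / 2 \<le>
      (knn_weight d \<beta> N g)\<^sup>2 * real (knn_count d \<beta> N n)"
proof -
  define a where "a = 2 * \<beta> + real d"
  define b where "b = 2 * g * \<beta> + real d"
  have a: "0 < a" and b: "0 < b" and gb: "0 < g * \<beta>" using \<beta> d g by (simp_all add: a_def b_def add_pos_pos)
  have N0: "0 < N" using N M by (smt (verit) powr_gt_zero)
  \<comment> \<open>x is the neighbour count before rounding; once N is large it exceeds y, which exceeds 1, so that
    rounding down loses at most a factor 2.\<close>
  define x where "x = real n * N powr (- (real d / a))"
  define y where "y = M powr (- (b / a)) * N powr (2 * g * \<beta> / a)"
  have "N / M > 0" using N0 M by simp
  have "(N / M) powr (b / a) \<le> (real n powr (a / b)) powr (b / a)"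
    using n \<open>N / M > 0\<close> a b by (intro powr_mono2) (auto simp: a_def b_def)
  also have "\<dots> = real n" using a b by (simp add: powr_powr)
  finally have "(N / M) powr (b / a) * N powr (- (real d / a)) \<le> x"
    unfolding x_def by (intro mult_right_mono) auto
  moreover have "(N / M) powr (b / a) * N powr (- (real d / a)) = y"
  proof -
    have "(N / M) powr (b / a) = N powr (b / a) * M powr (- (b / a))"
      using N0 M by (simp add: powr_divide powr_minus_divide)
    moreover have "N powr (b / a) * N powr (- (real d / a)) = N powr (2 * g * \<beta> / a)"
      by (simp only: powr_add[symmetric]) (simp add: b_def add_divide_distrib)
    ultimately show ?thesis by (simp add: y_def mult_ac)
  qed
  ultimately have yx: "y \<le> x" by simp
  have "M powr (b / a) = (M powr (b / (2 * g * \<beta>))) powr (2 * g * \<beta> / a)"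
    using \<beta> g by (simp add: powr_powr)
  also have "\<dots> \<le> N powr (2 * g * \<beta> / a)"
    using N \<beta> g a by (intro powr_mono2) (auto simp: b_def)
  finally have "M powr (- (b / a)) * M powr (b / a) \<le> y"
    unfolding y_def by (intro mult_left_mono) auto
  moreover have "M powr (- (b / a)) * M powr (b / a) = 1"
    using M by (simp add: powr_minus)
  ultimately have y1: "1 \<le> y" by simp
  have "x / 2 \<le> real (nat \<lfloor>x\<rfloor>)"
  proof -
    have f: "1 \<le> \<lfloor>x\<rfloor>" using yx y1 by (simp add: le_floor_iff)
    then have "1 \<le> real_of_int \<lfloor>x\<rfloor>" by linarith
    moreover have "x < real_of_int \<lfloor>x\<rfloor> + 1" by linarith
    moreover have "real (nat \<lfloor>x\<rfloor>) = real_of_int \<lfloor>x\<rfloor>" using f by simp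
    ultimately show ?thesis by linarith
  qed
  then have "y / 2 \<le> real (knn_count d \<beta> N n)"
    using yx by (simp add: knn_count_def x_def a_def)
  then have "N powr (- (2 * g * \<beta> / a)) * (y / 2) \<le> N powr (- (2 * g * \<beta> / a)) * real (knn_count d \<beta> N n)"
    by (intro mult_left_mono) auto
  moreover have "N powr (- (2 * g * \<beta> / a)) * (y / 2) = M powr (- (b / a)) / 2"
    using N0 by (simp add: y_def powr_minus)
  moreover have "(knn_weight d \<beta> N g)\<^sup>2 = N powr (- (2 * g * \<beta> / a))"
    unfolding knn_weight_def power2_eq_square powr_add[symmetric] by (simp add: a_def mult_ac)
  ultimately show ?thesis by (simp add: a_def b_def)
qed

text \<open>
  At least one of the \<open>m + 1\<close> terms of the effective size is not below their average.
\<close>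

lemma total_signal:
  assumes \<beta>: "0 < \<beta>" and d: "0 < d" and \<gamma>: "\<And>i. i \<in> {1..m} \<Longrightarrow> 0 < \<gamma> i"
  obtains v0 N0 where "0 < v0" "1 \<le> N0"
    "\<And>nP nQ N. N = effective_size d m \<beta> \<gamma> nP nQ \<Longrightarrow> N0 \<le> N \<Longrightarrow>
       v0 \<le> (knn_weight d \<beta> N 1)\<^sup>2 * real (knn_count d \<beta> N nQ) +
         (\<Sum>i=1..m. (knn_weight d \<beta> N (\<gamma> i))\<^sup>2 * real (knn_count d \<beta> N (nP i)))"
proof -
  define M where "M = real (m + 1)"
  have M: "1 \<le> M" by (simp add: M_def)
  \<comment> \<open>The target is a source with transfer exponent 1; it takes the free index 0.\<close>
  define G where "G i = (if i = 0 then 1 else \<gamma> i)" for i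
  have G: "0 < G i" if "i \<in> {0..m}" for i using that \<gamma>[of i] by (auto simp: G_def)
  obtain v0 where v0: "0 < v0" "\<And>i. i \<in> {0..m} \<Longrightarrow> v0 \<le> M powr (- ((2 * G i * \<beta> + real d) / (2 * \<beta> + real d))) / 2"
    by (rule finite_positive_lower_bound[of "{0..m}" "\<lambda>i. M powr (- ((2 * G i * \<beta> + real d) / (2 * \<beta> + real d))) / 2" 1])
       (use M in auto)
  define L where "L i = M powr ((2 * G i * \<beta> + real d) / (2 * G i * \<beta>))" for i
  define N0 where "N0 = Max (insert 1 (L ` {0..m}))"
  have N0: "1 \<le> N0" "\<And>i. i \<in> {0..m} \<Longrightarrow> L i \<le> N0"
    unfolding N0_def by (intro Max_ge, simp, force)+
  show ?thesis
  proof (rule that[OF v0(1) N0(1)])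
    fix nP nQ N assume N: "N = effective_size d m \<beta> \<gamma> nP nQ" "N0 \<le> N"
    define n where "n i = (if i = 0 then nQ else nP i)" for i
    define e where "e i = real (n i) powr ((2 * \<beta> + real d) / (2 * G i * \<beta> + real d))" for i
    define v where "v i = (knn_weight d \<beta> N (G i))\<^sup>2 * real (knn_count d \<beta> N (n i))" for i
    have split: "(\<Sum>i\<in>{0..m}. f i) = f 0 + (\<Sum>i=1..m. f i)" for f :: "nat \<Rightarrow> real"
      by (simp add: sum.atLeast_Suc_atMost)
    have Ne: "N = (\<Sum>i\<in>{0..m}. e i)"
      unfolding split N(1) effective_size_def using \<beta> d by (simp add: e_def n_def G_def)
    have "\<exists>i\<in>{0..m}. N / M \<le> e i"
    proof (rule ccontr)
      assume "\<not> ?thesis"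
      then have "(\<Sum>i\<in>{0..m}. e i) < (\<Sum>i\<in>{0..m}. N / M)"
        by (intro sum_strict_mono) (auto simp: not_le)
      then show False using M by (simp add: Ne[symmetric] M_def)
    qed
    then obtain i where i: "i \<in> {0..m}" "N / M \<le> e i" by blast
    have "v0 \<le> v i"
      using v0(2)[OF i(1)] source_signal[OF \<beta> d G[OF i(1)] M, of N "n i"] i N0(2)[OF i(1)] N(2)
      by (simp add: v_def e_def L_def)
    also have "\<dots> \<le> (\<Sum>i\<in>{0..m}. v i)"
      using i by (intro member_le_sum) (auto simp: v_def)
    also have "\<dots> = (knn_weight d \<beta> N 1)\<^sup>2 * real (knn_count d \<beta> N nQ) +
         (\<Sum>i=1..m. (knn_weight d \<beta> N (\<gamma> i))\<^sup>2 * real (knn_count d \<beta> N (nP i)))"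
      unfolding split by (simp add: v_def G_def n_def)
    finally show "v0 \<le> (knn_weight d \<beta> N 1)\<^sup>2 * real (knn_count d \<beta> N nQ) +
         (\<Sum>i=1..m. (knn_weight d \<beta> N (\<gamma> i))\<^sup>2 * real (knn_count d \<beta> N (nP i)))" .
  qed
qed

section \<open>Error probability at a point\<close>

text \<open>
  The radius is chosen such that smoothness moves \<open>\<eta>Q\<close> by at most half of the margin \<open>\<zeta>\<close>, so every
  point of the support in the ball votes for the same side as \<open>x\<close>; the relative signal condition passes
  this on to the sources.
\<close>

lemma local_gaps:
  fixes \<eta>Q \<eta>P :: "real^'d::finite \<Rightarrow> real"
  assumes smooth: "smooth_on \<beta> C\<^sub>\<beta> S \<eta>Q" and \<beta>: "0 < \<beta>" and C\<beta>: "0 < C\<^sub>\<beta>"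
    and x: "x \<in> S" and \<kappa>: "0 < \<kappa>" "\<kappa> \<le> 1 / (2 * C\<^sub>\<beta>)"
    and \<zeta>: "\<zeta> = \<bar>\<eta>Q x - 1/2\<bar>" "0 < \<zeta>" and \<sigma>: "\<sigma> = sgn (\<eta>Q x - 1/2)"
    and y: "y \<in> ball x ((\<kappa> * \<zeta>) powr (1 / \<beta>)) \<inter> S"
  shows "\<zeta> / 2 \<le> \<sigma> * (\<eta>Q y - 1/2)"
    and "\<lbrakk>relative_signal T g C \<eta>P \<eta>Q; y \<in> T; 0 < g; 0 < C\<rbrakk> \<Longrightarrow> C * (\<zeta> / 2) powr g \<le> \<sigma> * (\<eta>P y - 1/2)"
proof -
  have "\<bar>\<eta>Q x - \<eta>Q y\<bar> \<le> C\<^sub>\<beta> * norm (x - y) powr \<beta>"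
    using smooth x y by (auto simp: smooth_on_def)
  also have "\<dots> \<le> C\<^sub>\<beta> * ((\<kappa> * \<zeta>) powr (1 / \<beta>)) powr \<beta>"
    using y \<beta> C\<beta> by (intro mult_left_mono powr_mono2) (auto simp: dist_norm)
  also have "\<dots> = C\<^sub>\<beta> * \<kappa> * \<zeta>" using \<beta> \<kappa> \<zeta> by (simp add: powr_powr)
  also have "\<dots> \<le> (1 / 2) * \<zeta>"
    using \<kappa> C\<beta> \<zeta>(2) by (intro mult_right_mono) (auto simp: field_simps)
  finally have near: "\<bar>\<eta>Q x - \<eta>Q y\<bar> \<le> \<zeta> / 2" by simp
  show gap: "\<zeta> / 2 \<le> \<sigma> * (\<eta>Q y - 1/2)"
    using near \<zeta> \<sigma> by (auto simp: sgn_if abs_if split: if_splits)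
  assume rs: "relative_signal T g C \<eta>P \<eta>Q" "y \<in> T" "0 < g" "0 < C"
  have 1: "(\<eta>P y - 1/2) * (\<eta>Q y - 1/2) \<ge> 0" and 2: "\<bar>\<eta>P y - 1/2\<bar> \<ge> C * \<bar>\<eta>Q y - 1/2\<bar> powr g"
    using rs by (auto simp: relative_signal_def)
  have "C * (\<zeta> / 2) powr g \<le> C * \<bar>\<eta>Q y - 1/2\<bar> powr g"
    using gap \<sigma> \<zeta> rs by (intro mult_left_mono powr_mono2) (auto simp: sgn_if abs_if split: if_splits)
  also have "\<dots> \<le> \<bar>\<eta>P y - 1/2\<bar>" by (rule 2)
  also have "\<dots> = \<sigma> * (\<eta>P y - 1/2)"
  proof (cases "\<eta>Q x > 1/2")
    case True
    then have "\<sigma> = 1" "\<eta>Q y - 1/2 > 0" using \<sigma> gap \<zeta> by auto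
    then show ?thesis using 1 by (auto simp: zero_le_mult_iff)
  next
    case False
    then have "\<sigma> = -1" "\<eta>Q y - 1/2 < 0" using \<sigma> gap \<zeta> by (auto simp: sgn_if split: if_splits)
    then show ?thesis using 1 by (auto simp: zero_le_mult_iff)
  qed
  finally show "C * (\<zeta> / 2) powr g \<le> \<sigma> * (\<eta>P y - 1/2)" .
qed

text \<open>
  Write the margin at \<open>x\<close> as \<open>t * \<tau>\<close>. Then every source has bias at least \<open>c * t powr g\<close> times its weight
  on the ball, so signal and variance of its share of the vote are both multiples of \<open>w\<^sup>2 * k\<close>. One and
  the same \<open>l\<close> is therefore optimal for all sources at once, and the exponent only sees the total
  \<open>\<Sum> w\<^sup>2 * k\<close>, which is at least \<open>v0\<close>.
\<close>

lemma pointwise_exponential_error: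
  fixes P :: "nat \<Rightarrow> ('d::finite) pair measure" and m :: nat and \<beta> :: real and \<gamma> :: "nat \<Rightarrow> real"
    and nP :: "nat \<Rightarrow> nat" and nQ :: nat
  defines "N \<equiv> effective_size CARD('d) m \<beta> \<gamma> nP nQ"
  assumes m: "1 \<le> m" and \<beta>: "0 < \<beta>" and C\<beta>: "0 < C\<^sub>\<beta>" and lo: "0 < lo" and c\<mu>: "0 < c\<^sub>\<mu>"
    and \<gamma>: "\<And>i. i \<in> {1..m} \<Longrightarrow> 0 < \<gamma> i" and C: "\<And>i. i \<in> {1..m} \<Longrightarrow> 0 < C i"
    and cls: "(P, Q, \<eta>P, \<eta>Q) \<in> transfer_class m \<alpha> C\<^sub>\<alpha> \<beta> C\<^sub>\<beta> \<gamma> C lo hi c\<^sub>\<mu> r\<^sub>\<mu>"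
    and P: "\<And>i. pair_distribution (P i)"
    and \<kappa>: "0 < \<kappa>" "\<kappa> \<le> 1 / (2 * C\<^sub>\<beta>)" "\<kappa> powr (1 / \<beta>) \<le> r\<^sub>\<mu>"
    and B: "B = lo * c\<^sub>\<mu> * unit_ball_vol (real CARD('d)) * \<kappa> powr (real CARD('d) / \<beta>)"
    and c: "0 < c" "c \<le> 1 / 2" "\<And>i. i \<in> {1..m} \<Longrightarrow> c \<le> C i * 2 powr (- \<gamma> i)"
    and g: "0 < g" "g \<le> 1" "\<And>i. i \<in> {1..m} \<Longrightarrow> g \<le> \<gamma> i"
    and v0: "v0 \<le> (knn_weight CARD('d) \<beta> N 1)\<^sup>2 * real (knn_count CARD('d) \<beta> N nQ) +
         (\<Sum>i=1..m. (knn_weight CARD('d) \<beta> N (\<gamma> i))\<^sup>2 * real (knn_count CARD('d) \<beta> N (nP i)))"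
    and N: "1 \<le> N"
    and x: "x \<in> msupp (marginal Q)"
    and t: "\<bar>\<eta>Q x - 1/2\<bar> = t * knn_weight CARD('d) \<beta> N 1" "1 \<le> t" "4 \<le> B * t powr (real CARD('d) / \<beta>)"
  shows "(\<integral>\<^sup>+Z. of_bool (knn_classifier m \<beta> \<gamma> nP nQ Z x \<noteq> bayes_classifier \<eta>Q x) \<partial>data_measure m nP nQ P Q)
    \<le> ennreal (real (m + 1) * exp (- (B / 4) * t powr (real CARD('d) / \<beta>)) +
               exp (- (2 * c\<^sup>2 * v0) * t powr (2 * g)))"
proof -
  define d where "d = CARD('d)"
  have d: "0 < d" by (simp add: d_def)
  define S where "S = msupp (marginal Q)"
  define wP where "wP i = knn_weight d \<beta> N (\<gamma> i)" for i
  define wQ where "wQ = knn_weight d \<beta> N 1"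
  define kP where "kP i = knn_count d \<beta> N (nP i)" for i
  define kQ where "kQ = knn_count d \<beta> N nQ"
  define \<zeta> where "\<zeta> = \<bar>\<eta>Q x - 1/2\<bar>"
  define \<sigma> where "\<sigma> = sgn (\<eta>Q x - 1/2)"
  define r where "r = (\<kappa> * \<zeta>) powr (1 / \<beta>)"
  define u where "u = B * t powr (real d / \<beta>)"
  \<comment> \<open>The value of l minimizing (l w)^2 / 8 - l c t^g w^2, the same for all weights w.\<close>
  define l where "l = 4 * c * t powr g"
  have Q: "pair_distribution Q" "regression_function Q \<eta>Q"
    and \<eta>P: "\<And>i. i \<in> {1..m} \<Longrightarrow> regression_function (P i) (\<eta>P i)"
    and rs: "\<And>i. i \<in> {1..m} \<Longrightarrow> relative_signal (msupp (marginal (P i)) \<union> S) (\<gamma> i) (C i) (\<eta>P i) \<eta>Q"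
    and smooth: "smooth_on \<beta> C\<^sub>\<beta> S \<eta>Q"
    and supp: "\<And>i. i \<in> {1..m} \<Longrightarrow> msupp (marginal (P i)) = S"
    and densP: "\<And>i. i \<in> {1..m} \<Longrightarrow> density_between lo hi S (P i)"
    using cls by (auto simp: transfer_class_def S_def)
  have reg: "regular_set c\<^sub>\<mu> r\<^sub>\<mu> S" and densQ: "density_between lo hi S Q"
    using cls m by (auto simp: transfer_class_def S_def)
  have clS: "closed S" unfolding S_def by (rule closed_msupp_marginal[OF Q(1)])
  have xS: "x \<in> S" using x by (simp add: S_def)
  have wpos: "0 < wQ" "0 < wP i" for i using N by (simp_all add: wQ_def wP_def knn_weight_def)
  have \<zeta>t: "\<zeta> = t * wQ" using t(1) by (simp add: \<zeta>_def wQ_def d_def)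
  have \<zeta>0: "0 < \<zeta>" using \<zeta>t t(2) wpos by simp
  have \<zeta>1: "\<zeta> \<le> 1"
  proof -
    have "0 \<le> \<eta>Q x" "\<eta>Q x \<le> 1" using Q(2) by (auto simp: regression_function_def)
    then show ?thesis by (auto simp: \<zeta>_def abs_if)
  qed
  have \<sigma>: "\<bar>\<sigma>\<bar> = 1" using \<zeta>0 by (auto simp: \<sigma>_def \<zeta>_def sgn_if)
  have r: "0 < r" "r \<le> r\<^sub>\<mu>"
  proof -
    show "0 < r" using \<kappa> \<zeta>0 by (simp add: r_def)
    have "r \<le> \<kappa> powr (1 / \<beta>)"
      unfolding r_def using \<kappa> \<zeta>0 \<zeta>1 \<beta> by (intro powr_mono2) (auto simp: mult_left_le)
    then show "r \<le> r\<^sub>\<mu>" using \<kappa> by simp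
  qed
  define q where "q = lo * c\<^sub>\<mu> * unit_ball_vol (real d) * r ^ d"
  have q: "q = u * N powr (- (real d / (2 * \<beta> + real d)))"
  proof -
    have "r ^ d = (\<kappa> * \<zeta>) powr (real d / \<beta>)"
    proof -
      have "r ^ d = r powr real d" using r by (simp add: powr_realpow)
      then show ?thesis by (simp add: r_def powr_powr)
    qed
    also have "\<dots> = \<kappa> powr (real d / \<beta>) * (t powr (real d / \<beta>) * wQ powr (real d / \<beta>))"
      unfolding \<zeta>t by (simp add: powr_mult)
    also have "wQ powr (real d / \<beta>) = N powr (- (real d / (2 * \<beta> + real d)))"
      using \<beta> by (simp add: wQ_def knn_weight_def powr_powr)
    finally show ?thesis by (simp add: q_def u_def B d_def)
  qed
  have u: "4 \<le> u" using t(3) by (simp add: u_def d_def)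
  have nq: "u * real (knn_count d \<beta> N n) \<le> real n * q" for n
    using mult_left_mono[OF knn_count_le(1)[OF N \<beta>, of d n], of u] u by (simp add: q mult_ac)
  have mass: "q \<le> measure (marginal G) (ball x r)"
    if "pair_distribution G" "density_between lo hi S G" for G :: "'d pair measure"
    using ball_mass[OF that reg clS xS r] lo by (simp add: q_def d_def)
  have wg: "wQ powr h = knn_weight d \<beta> N h" for h
    by (simp add: wQ_def knn_weight_def powr_powr mult.commute)
  have gapP: "c * t powr g * wP i \<le> \<sigma> * (\<eta>P i y - 1/2)" if i: "i \<in> {1..m}" and y: "y \<in> ball x r \<inter> S" for i y
  proof -
    have "c * t powr g \<le> (C i * 2 powr (- \<gamma> i)) * t powr \<gamma> i"
      by (rule mult_mono[OF c(3)[OF i] powr_mono[OF g(3)[OF i] t(2)]]) (use C[OF i] in auto)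
    then have "c * t powr g * wP i \<le> (C i * 2 powr (- \<gamma> i)) * t powr \<gamma> i * wP i"
      using wpos(2)[of i] by (intro mult_right_mono) auto
    also have "\<dots> = C i * (\<zeta> / 2) powr \<gamma> i"
    proof -
      have "(\<zeta> / 2) powr \<gamma> i = (t powr \<gamma> i * wQ powr \<gamma> i) / 2 powr \<gamma> i"
        unfolding \<zeta>t by (simp only: powr_divide powr_mult)
      then have "C i * (\<zeta> / 2) powr \<gamma> i = C i * (t powr \<gamma> i * wP i / 2 powr \<gamma> i)"
        by (simp only: wg wP_def)
      also have "\<dots> = (C i * 2 powr (- \<gamma> i)) * t powr \<gamma> i * wP i"
        by (simp only: powr_minus divide_inverse mult_ac)
      finally show ?thesis by (rule sym)
    qed
    also have "\<dots> \<le> \<sigma> * (\<eta>P i y - 1/2)"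
      by (rule local_gaps(2)[OF smooth \<beta> C\<beta> xS \<kappa>(1,2) \<zeta>_def \<zeta>0 \<sigma>_def y[unfolded r_def] rs[OF i] _ \<gamma>[OF i] C[OF i]])
         (use y in simp)
    finally show ?thesis .
  qed
  have gapQ: "c * t powr g * wQ \<le> \<sigma> * (\<eta>Q y - 1/2)" if y: "y \<in> ball x r \<inter> S" for y
  proof -
    have "c * t powr g \<le> (1 / 2) * t powr 1"
      by (rule mult_mono[OF c(2) powr_mono[OF g(2) t(2)]]) auto
    then have "c * t powr g * wQ \<le> (1 / 2) * t powr 1 * wQ"
      using wpos(1) by (intro mult_right_mono) auto
    also have "\<dots> = \<zeta> / 2" using t(2) by (simp add: \<zeta>t)
    also have "\<dots> \<le> \<sigma> * (\<eta>Q y - 1/2)"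
      by (rule local_gaps(1)[OF smooth \<beta> C\<beta> xS \<kappa>(1,2) \<zeta>_def \<zeta>0 \<sigma>_def y[unfolded r_def]])
    finally show ?thesis .
  qed
  have farP: "(\<integral>\<^sup>+Z. indicator (- k_nearest_in (nP i) (kP i) x (ball x r \<inter> S)) Z \<partial>PiM {..<nP i} (\<lambda>_. P i)) \<le> ennreal (exp (- u / 4))"
    if i: "i \<in> {1..m}" for i
    using far_prob[OF P supp[OF i, symmetric] _ mass[OF P densP[OF i]] u nq] knn_count_le(2)[OF N \<beta>]
    by (simp add: kP_def)
  have farQ: "(\<integral>\<^sup>+Z. indicator (- k_nearest_in nQ kQ x (ball x r \<inter> S)) Z \<partial>PiM {..<nQ} (\<lambda>_. Q)) \<le> ennreal (exp (- u / 4))"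
    using far_prob[OF Q(1) S_def _ mass[OF Q(1) densQ] u nq] knn_count_le(2)[OF N \<beta>]
    by (simp add: kQ_def)
  have "(\<integral>\<^sup>+Z. of_bool (knn_classifier m \<beta> \<gamma> nP nQ Z x \<noteq> bayes_classifier \<eta>Q x) \<partial>data_measure m nP nQ P Q)
      \<le> (\<integral>\<^sup>+Z. of_bool (\<sigma> * vote m nP nQ kP kQ wP wQ Z x \<le> 0) \<partial>data_measure m nP nQ P Q)"
  proof (rule nn_integral_mono)
    fix Z
    have "knn_classifier m \<beta> \<gamma> nP nQ Z x \<longleftrightarrow> 0 < vote m nP nQ kP kQ wP wQ Z x"
      using knn_classifier_iff_vote[of m \<beta> \<gamma> nP nQ Z x] N
      by (simp add: kP_def[abs_def] kQ_def wP_def[abs_def] wQ_def d_def N_def)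
    then show "of_bool (knn_classifier m \<beta> \<gamma> nP nQ Z x \<noteq> bayes_classifier \<eta>Q x) \<le>
        (of_bool (\<sigma> * vote m nP nQ kP kQ wP wQ Z x \<le> 0) :: ennreal)"
      using \<zeta>0 by (auto simp: bayes_classifier_def \<sigma>_def sgn_if \<zeta>_def)
  qed
  also have "\<dots> \<le> ennreal (real (m + 1) * exp (- u / 4) +
        exp (real kQ * ((l * wQ)\<^sup>2 / 8 - l * wQ * (c * t powr g * wQ)) +
             (\<Sum>i=1..m. real (kP i) * ((l * wP i)\<^sup>2 / 8 - l * wP i * (c * t powr g * wP i)))))"
  proof (rule weighted_vote_error[OF P \<eta>P Q _ _ _ _ _ _ \<sigma> gapP gapQ farP farQ])
    show "ball x r \<inter> S \<in> sets borel" using clS by auto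
    show "0 \<le> l" using c by (simp add: l_def)
  qed (use knn_count_le(2)[OF N \<beta>] wpos in \<open>auto simp: kP_def kQ_def less_imp_le\<close>)
  also have "real kQ * ((l * wQ)\<^sup>2 / 8 - l * wQ * (c * t powr g * wQ)) +
             (\<Sum>i=1..m. real (kP i) * ((l * wP i)\<^sup>2 / 8 - l * wP i * (c * t powr g * wP i))) =
      - (2 * c\<^sup>2 * t powr (2 * g)) * (wQ\<^sup>2 * real kQ + (\<Sum>i=1..m. (wP i)\<^sup>2 * real (kP i)))"
  proof -
    have tg: "t powr (2 * g) = (t powr g)\<^sup>2" by (simp only: power2_eq_square powr_add[symmetric] mult_2)
    have "real k * ((l * w)\<^sup>2 / 8 - l * w * (c * t powr g * w)) = - (2 * c\<^sup>2 * t powr (2 * g)) * (w\<^sup>2 * real k)" for k w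
      unfolding tg l_def by (simp add: power2_eq_square algebra_simps)
    then show ?thesis by (simp only: distrib_left sum_distrib_left)
  qed
  also have "ennreal (real (m + 1) * exp (- u / 4) +
        exp (- (2 * c\<^sup>2 * t powr (2 * g)) * (wQ\<^sup>2 * real kQ + (\<Sum>i=1..m. (wP i)\<^sup>2 * real (kP i))))) \<le>
      ennreal (real (m + 1) * exp (- u / 4) + exp (- (2 * c\<^sup>2 * t powr (2 * g)) * v0))"
  proof (intro ennreal_leI add_left_mono iffD2[OF exp_le_cancel_iff] mult_left_mono_neg)
    show "v0 \<le> wQ\<^sup>2 * real kQ + (\<Sum>i=1..m. (wP i)\<^sup>2 * real (kP i))"
      using v0 by (simp add: wQ_def kQ_def wP_def kP_def d_def)
  qed simp
  finally show ?thesis by (simp add: u_def d_def mult_ac)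
qed

text \<open>
  From \<open>y \<le> exp y\<close>, raised to the power \<open>p / b\<close> at \<open>y = a * t powr b / (p / b)\<close>.
\<close>

lemma exp_neg_powr_le:
  fixes a b p t :: real
  assumes "0 < a" "0 < b" "0 < p" "0 < t"
  shows "exp (- a * t powr b) \<le> (a * b / p) powr (- (p / b)) * t powr (- p)"
proof -
  define q where "q = p / b"
  define y where "y = a * t powr b / q"
  have q: "0 < q" and y: "0 < y" using assms by (simp_all add: q_def y_def)
  have "y powr q \<le> exp y powr q"
    using y q exp_ge_add_one_self[of y] by (intro powr_mono2) linarith+
  also have "\<dots> = exp (a * t powr b)" using q by (simp add: y_def exp_powr_real)
  finally have "exp (- a * t powr b) \<le> inverse (y powr q)"
    using y by (simp add: exp_minus le_imp_inverse_le)
  also have "inverse (y powr q) = (a * b / p * t powr b) powr (- q)"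
    by (simp add: powr_minus y_def q_def field_simps)
  also have "\<dots> = (a * b / p) powr (- (p / b)) * t powr (- p)"
    using assms by (subst powr_mult) (simp_all add: powr_powr q_def)
  finally show ?thesis .
qed

text \<open>
  Fixes all constants before the sample sizes are known and weakens the exponential bound to a power
  of \<open>t\<close>, which is easier to integrate and also covers small \<open>t\<close>.
\<close>

lemma pointwise_polynomial_error:
  fixes \<beta> C\<^sub>\<beta> lo hi c\<^sub>\<mu> r\<^sub>\<mu> \<alpha> C\<^sub>\<alpha> p :: real and m :: nat and \<gamma> C :: "nat \<Rightarrow> real"
  assumes m: "1 \<le> m" and \<beta>: "0 < \<beta>" and C\<beta>: "0 < C\<^sub>\<beta>" and lo: "0 < lo" and c\<mu>: "0 < c\<^sub>\<mu>" "0 < r\<^sub>\<mu>"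
    and \<gamma>: "\<And>i. i \<in> {1..m} \<Longrightarrow> 0 < \<gamma> i" and C: "\<And>i. i \<in> {1..m} \<Longrightarrow> 0 < C i" and p: "0 < p"
  obtains K N0 where "1 \<le> K" "1 \<le> N0"
    "\<And>nP nQ N P Q \<eta>P \<eta>Q x t. \<lbrakk>N = effective_size CARD('d::finite) m \<beta> \<gamma> nP nQ; N0 \<le> N;
        (P, Q, \<eta>P, \<eta>Q) \<in> (transfer_class m \<alpha> C\<^sub>\<alpha> \<beta> C\<^sub>\<beta> \<gamma> C lo hi c\<^sub>\<mu> r\<^sub>\<mu> ::
          ((nat \<Rightarrow> 'd pair measure) \<times> 'd pair measure \<times> (nat \<Rightarrow> real^'d \<Rightarrow> real) \<times> (real^'d \<Rightarrow> real)) set);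
        \<And>i. pair_distribution (P i); x \<in> msupp (marginal Q);
        \<bar>\<eta>Q x - 1/2\<bar> = t * knn_weight CARD('d) \<beta> N 1; 0 < t\<rbrakk> \<Longrightarrow>
      (\<integral>\<^sup>+Z. of_bool (knn_classifier m \<beta> \<gamma> nP nQ Z x \<noteq> bayes_classifier \<eta>Q x) \<partial>data_measure m nP nQ P Q)
        \<le> ennreal (K * t powr (- p))"
proof -
  define d where "d = CARD('d)"
  have d: "0 < d" by (simp add: d_def)
  obtain v0 N0 where v0: "0 < v0" and N0: "1 \<le> N0" and signal:
    "\<And>nP nQ N. N = effective_size d m \<beta> \<gamma> nP nQ \<Longrightarrow> N0 \<le> N \<Longrightarrow>
       v0 \<le> (knn_weight d \<beta> N 1)\<^sup>2 * real (knn_count d \<beta> N nQ) +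
         (\<Sum>i=1..m. (knn_weight d \<beta> N (\<gamma> i))\<^sup>2 * real (knn_count d \<beta> N (nP i)))"
    using total_signal[where \<beta> = \<beta> and d = d and m = m and \<gamma> = \<gamma>, OF \<beta> d \<gamma>] by blast
  obtain c where c: "0 < c" "c \<le> 1 / 2" "\<And>i. i \<in> {1..m} \<Longrightarrow> c \<le> C i * 2 powr (- \<gamma> i)"
    by (rule finite_positive_lower_bound[of "{1..m}" "\<lambda>i. C i * 2 powr (- \<gamma> i)" "1 / 2"]) (use C in auto)
  obtain g where g: "0 < g" "g \<le> 1" "\<And>i. i \<in> {1..m} \<Longrightarrow> g \<le> \<gamma> i"
    by (rule finite_positive_lower_bound[of "{1..m}" \<gamma> 1]) (use \<gamma> in auto)
  \<comment> \<open>The first bound keeps the oscillation of \<open>\<eta>Q\<close> on the ball below half the margin, the second keeps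
    the radius in the range where the support is regular (the margin is at most 1).\<close>
  define \<kappa> where "\<kappa> = min (1 / (2 * C\<^sub>\<beta>)) (r\<^sub>\<mu> powr \<beta>)"
  have \<kappa>: "0 < \<kappa>" "\<kappa> \<le> 1 / (2 * C\<^sub>\<beta>)" "\<kappa> powr (1 / \<beta>) \<le> r\<^sub>\<mu>"
  proof -
    show "0 < \<kappa>" "\<kappa> \<le> 1 / (2 * C\<^sub>\<beta>)" using C\<beta> c\<mu> by (auto simp: \<kappa>_def)
    have "\<kappa> powr (1 / \<beta>) \<le> (r\<^sub>\<mu> powr \<beta>) powr (1 / \<beta>)"
      using \<open>0 < \<kappa>\<close> \<beta> by (intro powr_mono2) (auto simp: \<kappa>_def)
    then show "\<kappa> powr (1 / \<beta>) \<le> r\<^sub>\<mu>" using \<beta> c\<mu> by (simp add: powr_powr)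
  qed
  define B where "B = lo * c\<^sub>\<mu> * unit_ball_vol (real d) * \<kappa> powr (real d / \<beta>)"
  have B: "0 < B" using lo c\<mu> \<kappa> by (simp add: B_def unit_ball_vol_pos)
  define b where "b = real d / \<beta>"
  have b: "0 < b" using d \<beta> by (simp add: b_def)
  \<comment> \<open>Below T the bound is trivial: the error probability is at most 1 and T powr p enters K.\<close>
  define T where "T = max 1 ((4 / B) powr (1 / b))"
  define K1 where "K1 = (B / 4 * b / p) powr (- (p / b))"
  define K2 where "K2 = (2 * c\<^sup>2 * v0 * (2 * g) / p) powr (- (p / (2 * g)))"
  define K where "K = T powr p + (real (m + 1) * K1 + K2)"
  have T1: "1 \<le> T powr p" using p by (intro ge_one_powr_ge_zero) (auto simp: T_def)
  have Kpos: "0 \<le> real (m + 1) * K1 + K2" by (simp add: K1_def K2_def)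
  show ?thesis
  proof (rule that[of K N0])
    show "1 \<le> K" using T1 Kpos by (simp add: K_def)
    show "1 \<le> N0" by (rule N0)
    fix nP nQ N P Q \<eta>P \<eta>Q t and x :: "real^'d"
    assume N: "N = effective_size CARD('d) m \<beta> \<gamma> nP nQ" "N0 \<le> N"
      and cls: "(P, Q, \<eta>P, \<eta>Q) \<in> transfer_class m \<alpha> C\<^sub>\<alpha> \<beta> C\<^sub>\<beta> \<gamma> C lo hi c\<^sub>\<mu> r\<^sub>\<mu>"
      and P: "\<And>i. pair_distribution (P i :: 'd pair measure)"
      and x: "x \<in> msupp (marginal Q)"
      and t: "\<bar>\<eta>Q x - 1/2\<bar> = t * knn_weight CARD('d) \<beta> N 1" "0 < t"
    let ?err = "\<integral>\<^sup>+Z. of_bool (knn_classifier m \<beta> \<gamma> nP nQ Z x \<noteq> bayes_classifier \<eta>Q x) \<partial>data_measure m nP nQ P Q"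
    have Q: "pair_distribution Q" using cls by (auto simp: transfer_class_def)
    show "?err \<le> ennreal (K * t powr (- p))"
    proof (cases "t < T")
      case True
      interpret D: prob_space "data_measure m nP nQ P Q"
        unfolding data_measure_def using P Q
        by (intro prob_space_pair prob_space_PiM) (auto simp: pair_distribution_def)
      have "?err \<le> (\<integral>\<^sup>+Z. 1 \<partial>data_measure m nP nQ P Q)" by (intro nn_integral_mono) auto
      also have "\<dots> = ennreal 1" by (simp add: D.emeasure_space_1)
      also have "\<dots> \<le> ennreal (K * t powr (- p))"
      proof (rule ennreal_leI)
        have "T powr (- p) \<le> t powr (- p)" using True t p by (intro powr_mono2') auto
        then have "T powr p * T powr (- p) \<le> T powr p * t powr (- p)" by (intro mult_left_mono) auto
        also have "T powr p * T powr (- p) = 1" by (simp add: T_def powr_minus)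
        also have "T powr p * t powr (- p) \<le> K * t powr (- p)"
          using Kpos by (intro mult_right_mono) (auto simp: K_def)
        finally show "1 \<le> K * t powr (- p)" .
      qed
      finally show ?thesis .
    next
      case False
      then have t1: "1 \<le> t" and tB: "(4 / B) powr (1 / b) \<le> t" by (auto simp: T_def)
      have "4 / B = ((4 / B) powr (1 / b)) powr b" using B b by (simp add: powr_powr)
      also have "\<dots> \<le> t powr b" using tB b by (intro powr_mono2) auto
      finally have "4 \<le> B * t powr b" using B by (simp add: field_simps)
      then have "?err \<le> ennreal (real (m + 1) * exp (- (B / 4) * t powr b) + exp (- (2 * c\<^sup>2 * v0) * t powr (2 * g)))"
        using signal[OF N(1)[folded d_def] N(2)] N N0 t1 t
        by (intro pointwise_exponential_error[OF m \<beta> C\<beta> lo c\<mu>(1) \<gamma> C cls P \<kappa> _ c g _ _ x, folded d_def, folded b_def])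
           (auto simp: B_def d_def b_def)
      also have "\<dots> \<le> ennreal (K * t powr (- p))"
      proof (rule ennreal_leI)
        have "exp (- (B / 4) * t powr b) \<le> K1 * t powr (- p)"
          unfolding K1_def using B b p t by (intro exp_neg_powr_le) auto
        then have "real (m + 1) * exp (- (B / 4) * t powr b) \<le> real (m + 1) * (K1 * t powr (- p))"
          by (intro mult_left_mono) auto
        moreover have "exp (- (2 * c\<^sup>2 * v0) * t powr (2 * g)) \<le> K2 * t powr (- p)"
          unfolding K2_def using c v0 g p t by (intro exp_neg_powr_le) auto
        moreover have "0 \<le> T powr p * t powr (- p)" by simp
        moreover have "K * t powr (- p) = T powr p * t powr (- p) + (real (m + 1) * (K1 * t powr (- p)) + K2 * t powr (- p))"
          by (simp add: K_def algebra_simps)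
        ultimately show "real (m + 1) * exp (- (B / 4) * t powr b) + exp (- (2 * c\<^sup>2 * v0) * t powr (2 * g)) \<le> K * t powr (- p)"
          by linarith
      qed
      finally show ?thesis .
    qed
  qed
qed

section \<open>Integrating the pointwise error\<close>

text \<open>
  Cuts the margin \<open>\<zeta>\<close> into dyadic shells starting at \<open>\<tau>\<close>. On the shell of index \<open>j\<close> the integrand has
  order \<open>\<tau> * 2 powr (- j * (1 + \<alpha>))\<close>, the mass has order \<open>(2 ^ j * \<tau>) powr \<alpha>\<close>, so the contributions
  decay geometrically. This is what the exponent \<open>2 + \<alpha>\<close> in the decay of \<open>e\<close> is chosen for.
\<close>

lemma margin_shell_integral:
  fixes M :: "'a measure" and \<zeta> :: "'a \<Rightarrow> real" and e :: "'a \<Rightarrow> ennreal"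
  assumes [measurable]: "\<zeta> \<in> borel_measurable M" and M: "finite_measure M"
    and \<zeta>: "\<And>x. 0 \<le> \<zeta> x"
    and margin: "\<And>t. 0 < t \<Longrightarrow> measure M {x \<in> space M. 0 < \<zeta> x \<and> \<zeta> x < t} \<le> C * t powr \<alpha>"
    and C: "0 \<le> C" and \<alpha>: "0 \<le> \<alpha>" and \<tau>: "0 < \<tau>" and K: "1 \<le> K"
    and e1: "\<And>x. x \<in> space M \<Longrightarrow> e x \<le> 1"
    and e: "\<And>x. x \<in> space M \<Longrightarrow> 0 < \<zeta> x \<Longrightarrow> e x \<le> ennreal (K * (\<zeta> x / \<tau>) powr (- (2 + \<alpha>)))"
  shows "(\<integral>\<^sup>+x. ennreal (\<zeta> x) * e x \<partial>M) \<le> ennreal (2 powr (3 + \<alpha>) * K * C * \<tau> powr (1 + \<alpha>))"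
proof -
  interpret finite_measure M by fact
  \<comment> \<open>a j bounds the integrand on the shell between T (j - 1) and T j, and also (for j = 0) below T 0;
    enlarging the shell to B j lets the margin condition apply.\<close>
  define T where "T j = 2 ^ j * \<tau>" for j :: nat
  define a where "a j = \<tau> * K * 2 powr (2 + \<alpha>) * 2 powr (- (real j * (1 + \<alpha>)))" for j :: nat
  define B where "B j = {x \<in> space M. 0 < \<zeta> x \<and> \<zeta> x < T j}" for j
  have [measurable]: "B j \<in> sets M" for j unfolding B_def by measurable
  have T: "0 < T j" for j using \<tau> by (simp add: T_def)
  have a: "0 \<le> a j" for j using \<tau> K by (simp add: a_def)
  have pw: "ennreal (\<zeta> x) * e x \<le> (\<Sum>j. ennreal (a j) * indicator (B j) x)" if x: "x \<in> space M" for x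
  proof (cases "\<zeta> x = 0")
    case False
    then have z: "0 < \<zeta> x" using \<zeta>[of x] by simp
    obtain j0 :: nat where "\<zeta> x / \<tau> < 2 ^ j0" using real_arch_pow[of 2 "\<zeta> x / \<tau>"] by auto
    then have ex: "\<exists>j. \<zeta> x < T j" using \<tau> by (auto simp: T_def field_simps)
    define j where "j = (LEAST j. \<zeta> x < T j)"
    have j: "\<zeta> x < T j" unfolding j_def using ex by (rule LeastI_ex)
    have "ennreal (\<zeta> x) * e x \<le> ennreal (a j)"
    proof (cases j)
      case 0
      have "ennreal (\<zeta> x) * e x \<le> ennreal (\<zeta> x) * 1" using e1[OF x] by (intro mult_left_mono) auto
      also have "\<dots> \<le> ennreal (a j)"
      proof -
        have "1 \<le> K * 2 powr (2 + \<alpha>)" 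
          using mult_mono[of 1 K 1 "2 powr (2 + \<alpha>)"] K \<alpha> by (simp add: ge_one_powr_ge_zero)
        then have "\<tau> * 1 \<le> \<tau> * (K * 2 powr (2 + \<alpha>))" using \<tau> by (intro mult_left_mono) auto
        then show ?thesis using j 0 by (auto simp: T_def a_def mult.assoc intro!: ennreal_leI)
      qed
      finally show ?thesis .
    next
      case (Suc i)
      have low: "T i \<le> \<zeta> x" using not_less_Least[of i "\<lambda>j. \<zeta> x < T j"] Suc by (simp add: j_def)
      have "ennreal (\<zeta> x) * e x \<le> ennreal (\<zeta> x) * ennreal (K * (\<zeta> x / \<tau>) powr (- (2 + \<alpha>)))"
        using e[OF x z] by (intro mult_left_mono) auto
      also have "\<dots> = ennreal (\<zeta> x * (K * (\<zeta> x / \<tau>) powr (- (2 + \<alpha>))))"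
        using z by (simp add: ennreal_mult')
      also have "\<dots> \<le> ennreal (a j)"
      proof (rule ennreal_leI)
        have "2 ^ i \<le> \<zeta> x / \<tau>" using low \<tau> by (simp add: T_def field_simps)
        then have "(\<zeta> x / \<tau>) powr (- (2 + \<alpha>)) \<le> (2 ^ i) powr (- (2 + \<alpha>))"
          using \<alpha> by (intro powr_mono2') auto
        then have "\<zeta> x * (K * (\<zeta> x / \<tau>) powr (- (2 + \<alpha>))) \<le> T j * (K * (2 ^ i) powr (- (2 + \<alpha>)))"
          using j K z T[of j] by (intro mult_mono) auto
        also have "(2 ^ i :: real) powr (- (2 + \<alpha>)) = 2 powr (2 + \<alpha>) * 2 powr (- (real j * (2 + \<alpha>)))"
        proof -
          have "(2 ^ i :: real) powr (- (2 + \<alpha>)) = 2 powr (real i * (- (2 + \<alpha>)))"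
            by (simp only: powr_realpow[symmetric] powr_powr zero_less_numeral)
          also have "real i * (- (2 + \<alpha>)) = (2 + \<alpha>) + (- (real j * (2 + \<alpha>)))"
            by (simp add: Suc algebra_simps)
          finally show ?thesis by (simp only: powr_add)
        qed
        also have "T j = \<tau> * 2 powr (real j)" by (simp add: T_def powr_realpow)
        also have "\<tau> * 2 powr (real j) * (K * (2 powr (2 + \<alpha>) * 2 powr (- (real j * (2 + \<alpha>))))) = a j"
        proof -
          have "2 powr (- (real j * (1 + \<alpha>))) = 2 powr (real j) * 2 powr (- (real j * (2 + \<alpha>)))"
            by (simp only: powr_add[symmetric]) (simp add: algebra_simps)
          then show ?thesis by (simp add: a_def)
        qed
        finally show "\<zeta> x * (K * (\<zeta> x / \<tau>) powr (- (2 + \<alpha>))) \<le> a j" .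
      qed
      finally show ?thesis .
    qed
    also have "\<dots> = ennreal (a j) * indicator (B j) x" using x z j by (simp add: B_def)
    also have "\<dots> \<le> (\<Sum>j. ennreal (a j) * indicator (B j) x)"
    proof -
      have "f j \<le> suminf f" for f :: "nat \<Rightarrow> ennreal"
        using sum_le_suminf[OF summableI, of "{j}" f] by simp
      from this[of "\<lambda>j. ennreal (a j) * indicator (B j) x"] show ?thesis .
    qed
    finally show ?thesis .
  qed simp
  define D where "D = 2 powr (2 + \<alpha>) * K * C * \<tau> powr (1 + \<alpha>)"
  have D: "0 \<le> D" using K C by (simp add: D_def)
  have "(\<integral>\<^sup>+x. ennreal (\<zeta> x) * e x \<partial>M) \<le> (\<integral>\<^sup>+x. (\<Sum>j. ennreal (a j) * indicator (B j) x) \<partial>M)"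
    by (intro nn_integral_mono pw)
  also have "\<dots> = (\<Sum>j. \<integral>\<^sup>+x. ennreal (a j) * indicator (B j) x \<partial>M)"
    by (rule nn_integral_suminf) measurable
  also have "\<dots> = (\<Sum>j. ennreal (a j * measure M (B j)))"
    using a by (simp add: nn_integral_cmult_indicator emeasure_eq_measure ennreal_mult)
  also have "\<dots> \<le> (\<Sum>j. ennreal (D * (1/2) ^ j))"
  proof (intro suminf_le summableI ennreal_leI)
    fix j :: nat
    have "a j * measure M (B j) \<le> a j * (C * T j powr \<alpha>)"
      using margin[OF T[of j]] a by (intro mult_left_mono) (auto simp: B_def)
    also have "\<dots> = D * (1/2) ^ j"
    proof -
      have 1: "T j powr \<alpha> = 2 powr (real j * \<alpha>) * \<tau> powr \<alpha>"
      proof -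
        have "T j powr \<alpha> = (2 powr real j * \<tau>) powr \<alpha>" by (simp add: T_def powr_realpow)
        also have "\<dots> = (2 powr real j) powr \<alpha> * \<tau> powr \<alpha>" by (rule powr_mult)
        finally show ?thesis by (simp only: powr_powr)
      qed
      have 2: "\<tau> powr (1 + \<alpha>) = \<tau> * \<tau> powr \<alpha>" using \<tau> by (simp add: powr_add)
      have "2 powr (- (real j * (1 + \<alpha>))) * 2 powr (real j * \<alpha>) = 2 powr (- real j)"
        by (simp only: powr_add[symmetric]) (simp add: algebra_simps)
      also have "\<dots> = inverse (2 ^ j)" by (simp add: powr_minus powr_realpow)
      also have "\<dots> = (1/2 :: real) ^ j" by (simp add: power_one_over inverse_eq_divide)
      finally have 3: "2 powr (- (real j * (1 + \<alpha>))) * 2 powr (real j * \<alpha>) = (1/2 :: real) ^ j" .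
      have "a j * (C * T j powr \<alpha>) = 2 powr (2 + \<alpha>) * K * C * (\<tau> * \<tau> powr \<alpha>) *
          (2 powr (- (real j * (1 + \<alpha>))) * 2 powr (real j * \<alpha>))"
        by (simp add: a_def 1)
      then show ?thesis unfolding 3 D_def 2 .
    qed
    finally show "a j * measure M (B j) \<le> D * (1/2) ^ j" .
  qed
  also have "\<dots> = ennreal (\<Sum>j. D * (1/2) ^ j)"
    by (rule suminf_ennreal2) (use D in \<open>simp_all add: summable_mult summable_geometric\<close>)
  also have "(\<Sum>j. D * (1/2) ^ j) = D * 2"
    using suminf_mult[OF summable_geometric, of "1/2 :: real" D] by (simp add: suminf_geometric)
  also have "D * 2 = 2 powr (3 + \<alpha>) * K * C * \<tau> powr (1 + \<alpha>)"
  proof -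
    have "2 powr (3 + \<alpha>) = 2 * 2 powr (2 + \<alpha> :: real)"
      using powr_add[of "2::real" 1 "2 + \<alpha>"] by simp
    then show ?thesis by (simp add: D_def)
  qed
  finally show ?thesis .
qed

text \<open>
  A non-integrable \<open>f\<close> has integral 0 by convention, which \<open>0 \<le> B\<close> covers.
\<close>

lemma integral_le_nn_integral_bound:
  assumes "\<And>x. x \<in> space M \<Longrightarrow> 0 \<le> f x" and le: "(\<integral>\<^sup>+x. ennreal (f x) \<partial>M) \<le> ennreal B" and B: "0 \<le> B"
  shows "(\<integral>x. f x \<partial>M) \<le> B"
proof (cases "integrable M f")
  case True
  then have "(\<integral>\<^sup>+x. ennreal (f x) \<partial>M) = ennreal (\<integral>x. f x \<partial>M)"
    using assms(1) by (intro nn_integral_eq_integral AE_I2)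
  then show ?thesis using le B by (simp add: ennreal_le_iff)
qed (simp add: not_integrable_integral_eq B)

lemma expected_excess_risk_le_1:
  fixes P :: "nat \<Rightarrow> ('d::finite) pair measure"
  assumes P: "\<And>i. pair_distribution (P i)" and Q: "pair_distribution Q" and \<eta>: "regression_function Q \<eta>Q"
    and N: "0 < effective_size CARD('d) m \<beta> \<gamma> nP nQ"
  shows "(\<integral>Z. excess_risk Q \<eta>Q (knn_classifier m \<beta> \<gamma> nP nQ Z) \<partial>data_measure m nP nQ P Q) \<le> 1"
proof -
  have sP: "sets (P i) = sets pair_space" and sQ: "sets Q = sets pair_space" for i
    using P Q by (auto simp: pair_distribution_def)
  interpret Q: prob_space Q using Q by (simp add: pair_distribution_def)
  interpret D: prob_space "data_measure m nP nQ P Q"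
    unfolding data_measure_def using P Q
    by (intro prob_space_pair prob_space_PiM) (auto simp: pair_distribution_def)
  show ?thesis
  proof (rule integral_le_nn_integral_bound)
    show "0 \<le> excess_risk Q \<eta>Q (knn_classifier m \<beta> \<gamma> nP nQ Z)"
      if "Z \<in> space (data_measure m nP nQ P Q)" for Z
      by (rule excess_risk_nn_integral(2)[OF Q \<eta> pred_knn_classifier[OF sP sQ N that]])
    have "excess_risk Q \<eta>Q f \<le> 1" for f
      using Q.prob_le_1[of "{z \<in> space Q. snd z \<noteq> f (fst z)}"]
        measure_nonneg[of Q "{z \<in> space Q. snd z \<noteq> bayes_classifier \<eta>Q (fst z)}"]
      unfolding excess_risk_def risk_def by linarith
    then have "(\<integral>\<^sup>+Z. ennreal (excess_risk Q \<eta>Q (knn_classifier m \<beta> \<gamma> nP nQ Z)) \<partial>data_measure m nP nQ P Q)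
        \<le> (\<integral>\<^sup>+Z. ennreal 1 \<partial>data_measure m nP nQ P Q)"
      by (intro nn_integral_mono ennreal_leI)
    then show "(\<integral>\<^sup>+Z. ennreal (excess_risk Q \<eta>Q (knn_classifier m \<beta> \<gamma> nP nQ Z)) \<partial>data_measure m nP nQ P Q) \<le> ennreal 1"
      by (simp add: D.emeasure_space_1)
  qed simp
qed

text \<open>
  By Fubini the expected excess risk is the integral over \<open>x\<close> of twice the margin times the error
  probability at \<open>x\<close>. Off the support the margin vanishes, so the pointwise bound is needed on the
  support only.
\<close>

lemma expected_excess_risk_le:
  fixes P :: "nat \<Rightarrow> ('d::finite) pair measure"
  assumes P: "\<And>i. pair_distribution (P i)" and Q: "pair_distribution Q" and \<eta>: "regression_function Q \<eta>Q"
    and N: "0 < effective_size CARD('d) m \<beta> \<gamma> nP nQ"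
    and margin: "margin_condition \<alpha> C\<^sub>\<alpha> Q \<eta>Q" and C\<alpha>: "0 \<le> C\<^sub>\<alpha>" and \<alpha>: "0 \<le> \<alpha>"
    and \<tau>: "0 < \<tau>" and K: "1 \<le> K"
    and err: "\<And>x. x \<in> msupp (marginal Q) \<Longrightarrow> \<eta>Q x \<noteq> 1/2 \<Longrightarrow>
      (\<integral>\<^sup>+Z. of_bool (knn_classifier m \<beta> \<gamma> nP nQ Z x \<noteq> bayes_classifier \<eta>Q x) \<partial>data_measure m nP nQ P Q)
        \<le> ennreal (K * (\<bar>\<eta>Q x - 1/2\<bar> / \<tau>) powr (- (2 + \<alpha>)))"
  shows "(\<integral>Z. excess_risk Q \<eta>Q (knn_classifier m \<beta> \<gamma> nP nQ Z) \<partial>data_measure m nP nQ P Q)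
    \<le> 2 powr (4 + \<alpha>) * K * C\<^sub>\<alpha> * \<tau> powr (1 + \<alpha>)"
proof -
  define D where "D = data_measure m nP nQ P Q"
  define f :: "'d data \<Rightarrow> real^'d \<Rightarrow> bool" where "f = knn_classifier m \<beta> \<gamma> nP nQ"
  define W :: "'d data \<Rightarrow> real^'d \<Rightarrow> ennreal" where "W Z x = of_bool (f Z x \<noteq> bayes_classifier \<eta>Q x)" for Z x
  define \<zeta> where "\<zeta> x = \<bar>\<eta>Q x - 1/2\<bar>" for x
  have sP: "sets (P i) = sets pair_space" and sQ: "sets Q = sets pair_space" for i
    using P Q by (auto simp: pair_distribution_def)
  interpret Q: prob_space Q using Q by (simp add: pair_distribution_def)
  interpret D: prob_space D
    unfolding D_def data_measure_def using P Q
    by (intro prob_space_pair prob_space_PiM) (auto simp: pair_distribution_def)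
  note fst[measurable] = measurable_pair_projections(1)[OF sQ]
  interpret X: prob_space "marginal Q" by (rule prob_space_marginal[OF Q])
  interpret DX: pair_sigma_finite D "marginal Q" by unfold_locales
  note sX = sets_marginal[of Q]
  have [measurable]: "\<eta>Q \<in> borel_measurable borel" using \<eta> by (simp add: regression_function_def)
  have [measurable]: "\<zeta> \<in> borel_measurable borel" unfolding \<zeta>_def by measurable
  have [measurable]: "Measurable.pred borel (bayes_classifier \<eta>Q)"
    unfolding bayes_classifier_def by measurable
  have f_joint[measurable]: "Measurable.pred (D \<Otimes>\<^sub>M borel) (\<lambda>p. f (fst p) (snd p))"
    using measurable_knn_classifier[OF sP sQ N] by (simp add: D_def f_def split_beta)
  have fZ: "Measurable.pred borel (f Z)" if "Z \<in> space D" for Z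
    using pred_knn_classifier[OF sP sQ N] that by (simp add: D_def f_def)
  have W_joint: "(\<lambda>p. ennreal (2 * \<zeta> (snd p)) * W (fst p) (snd p)) \<in> borel_measurable (D \<Otimes>\<^sub>M borel)"
    unfolding W_def by measurable
  have excess: "ennreal (excess_risk Q \<eta>Q (f Z)) = (\<integral>\<^sup>+x. ennreal (2 * \<zeta> x) * W Z x \<partial>marginal Q)"
    if Z: "Z \<in> space D" for Z
  proof -
    note [measurable] = fZ[OF Z]
    have m: "(\<lambda>x. ennreal (2 * \<zeta> x) * W Z x) \<in> borel_measurable borel"
      unfolding W_def by measurable
    show ?thesis
      unfolding excess_risk_nn_integral(1)[OF Q \<eta> fZ[OF Z]] marginal_def
      by (subst nn_integral_distr[OF fst]) (use m in \<open>simp_all add: W_def \<zeta>_def\<close>)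
  qed
  have "(\<integral>\<^sup>+Z. ennreal (excess_risk Q \<eta>Q (f Z)) \<partial>D) =
      (\<integral>\<^sup>+Z. (\<integral>\<^sup>+x. ennreal (2 * \<zeta> x) * W Z x \<partial>marginal Q) \<partial>D)"
    by (intro nn_integral_cong excess)
  also have "\<dots> = (\<integral>\<^sup>+x. (\<integral>\<^sup>+Z. ennreal (2 * \<zeta> x) * W Z x \<partial>D) \<partial>marginal Q)"
  proof (rule DX.Fubini'[symmetric])
    show "(\<lambda>(Z, x). ennreal (2 * \<zeta> x) * W Z x) \<in> borel_measurable (D \<Otimes>\<^sub>M marginal Q)"
      using W_joint by (subst measurable_cong_sets[OF sets_pair_measure_cong[OF refl sX] refl]) (simp add: split_beta)
  qed
  also have "\<dots> = (\<integral>\<^sup>+x. 2 * (ennreal (\<zeta> x) * (\<integral>\<^sup>+Z. W Z x \<partial>D)) \<partial>marginal Q)"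
  proof (intro nn_integral_cong)
    fix x
    have [measurable]: "(\<lambda>Z. W Z x) \<in> borel_measurable D"
      using measurable_compose[OF measurable_Pair2'[of x borel D] f_joint] unfolding W_def by simp
    have "ennreal (2 * \<zeta> x) = 2 * ennreal (\<zeta> x)" by (simp add: \<zeta>_def ennreal_mult')
    then show "(\<integral>\<^sup>+Z. ennreal (2 * \<zeta> x) * W Z x \<partial>D) = 2 * (ennreal (\<zeta> x) * (\<integral>\<^sup>+Z. W Z x \<partial>D))"
      by (simp add: nn_integral_cmult mult.assoc)
  qed
  also have "\<dots> = 2 * (\<integral>\<^sup>+x. ennreal (\<zeta> x) * (\<integral>\<^sup>+Z. W Z x \<partial>D) \<partial>marginal Q)"
  proof (rule nn_integral_cmult)
    have "(\<lambda>p. W (snd p) (fst p)) \<in> borel_measurable (borel \<Otimes>\<^sub>M D)"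
      using measurable_compose[OF measurable_Pair[OF measurable_snd measurable_fst] f_joint]
      unfolding W_def by simp
    from D.borel_measurable_nn_integral_fst[OF this]
    have "(\<lambda>x. \<integral>\<^sup>+Z. W Z x \<partial>D) \<in> borel_measurable borel" by simp
    then have "(\<lambda>x. ennreal (\<zeta> x) * (\<integral>\<^sup>+Z. W Z x \<partial>D)) \<in> borel_measurable borel"
      by (rule borel_measurable_times_ennreal[rotated]) measurable
    then show "(\<lambda>x. ennreal (\<zeta> x) * (\<integral>\<^sup>+Z. W Z x \<partial>D)) \<in> borel_measurable (marginal Q)"
      by (subst measurable_cong_sets[OF sX refl])
  qed
  also have "\<dots> \<le> 2 * ennreal (2 powr (3 + \<alpha>) * K * C\<^sub>\<alpha> * \<tau> powr (1 + \<alpha>))"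
  proof (intro mult_left_mono margin_shell_integral[OF _ X.finite_measure_axioms _ _ C\<alpha> \<alpha> \<tau> K])
    show "\<zeta> \<in> borel_measurable (marginal Q)" by (subst measurable_cong_sets[OF sX refl]) measurable
    show "measure (marginal Q) {x \<in> space (marginal Q). 0 < \<zeta> x \<and> \<zeta> x < t} \<le> C\<^sub>\<alpha> * t powr \<alpha>" if "0 < t" for t
      using margin that by (simp add: margin_condition_def \<zeta>_def marginal_def)
    fix x
    show "0 \<le> \<zeta> x" by (simp add: \<zeta>_def)
    have "(\<integral>\<^sup>+Z. W Z x \<partial>D) \<le> (\<integral>\<^sup>+Z. 1 \<partial>D)" by (intro nn_integral_mono) (simp add: W_def)
    then show "(\<integral>\<^sup>+Z. W Z x \<partial>D) \<le> 1" by (simp add: D.emeasure_space_1)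
    assume z: "0 < \<zeta> x"
    then have "x \<in> msupp (marginal Q)" using \<eta> by (auto simp: regression_function_def \<zeta>_def)
    then show "(\<integral>\<^sup>+Z. W Z x \<partial>D) \<le> ennreal (K * (\<zeta> x / \<tau>) powr (- (2 + \<alpha>)))"
      using err[of x] z by (simp add: W_def f_def D_def \<zeta>_def)
  qed simp
  also have "\<dots> = ennreal (2 powr (4 + \<alpha>) * K * C\<^sub>\<alpha> * \<tau> powr (1 + \<alpha>))"
  proof -
    have "2 powr (4 + \<alpha>) = 2 * 2 powr (3 + \<alpha> :: real)"
      using powr_add[of "2::real" 1 "3 + \<alpha>"] by simp
    then have "2 powr (4 + \<alpha>) * K * C\<^sub>\<alpha> * \<tau> powr (1 + \<alpha>) = 2 * (2 powr (3 + \<alpha>) * K * C\<^sub>\<alpha> * \<tau> powr (1 + \<alpha>))"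
      by (simp only: mult.assoc)
    then show ?thesis by (simp only: ennreal_mult' ennreal_numeral zero_le_numeral)
  qed
  finally have le: "(\<integral>\<^sup>+Z. ennreal (excess_risk Q \<eta>Q (f Z)) \<partial>D) \<le> ennreal (2 powr (4 + \<alpha>) * K * C\<^sub>\<alpha> * \<tau> powr (1 + \<alpha>))" .
  have "(\<integral>Z. excess_risk Q \<eta>Q (f Z) \<partial>D) \<le> 2 powr (4 + \<alpha>) * K * C\<^sub>\<alpha> * \<tau> powr (1 + \<alpha>)"
    using excess_risk_nn_integral(2)[OF Q \<eta> fZ] K C\<alpha>
    by (intro integral_le_nn_integral_bound[OF _ le]) auto
  then show ?thesis by (simp add: f_def D_def)
qed

theorem theorem7p1:
  fixes m :: nat
    and \<alpha> C\<^sub>\<alpha> \<beta> C\<^sub>\<beta> \<mu>lo \<mu>hi c\<^sub>\<mu> r\<^sub>\<mu> :: real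
    and \<gamma> C :: "nat \<Rightarrow> real"
  assumes "m \<ge> 1"
    and "\<alpha> \<ge> 0" and "C\<^sub>\<alpha> > 0"
    and "0 < \<beta>" and "\<beta> \<le> 1" and "C\<^sub>\<beta> > 0"
    and "\<And>i. i \<in> {1..m} \<Longrightarrow> \<gamma> i > 0"
    and "\<And>i. i \<in> {1..m} \<Longrightarrow> C i > 0"
    and "0 < \<mu>lo" and "\<mu>lo < \<mu>hi"
    and "c\<^sub>\<mu> > 0" and "r\<^sub>\<mu> > 0"
    and "\<alpha> * \<beta> \<le> real CARD('d::finite)"
  shows "\<exists>K>0. \<forall>(nP :: nat \<Rightarrow> nat) (nQ :: nat).
    (nQ > 0 \<or> (\<exists>i\<in>{1..m}. nP i > 0)) \<longrightarrow>
    (SUP (P, Q, \<eta>P, \<eta>Q) \<in> (transfer_class m \<alpha> C\<^sub>\<alpha> \<beta> C\<^sub>\<beta> \<gamma> C \<mu>lo \<mu>hi c\<^sub>\<mu> r\<^sub>\<mu> ::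
        ((nat \<Rightarrow> 'd pair measure) \<times> 'd pair measure \<times>
         (nat \<Rightarrow> real^'d \<Rightarrow> real) \<times> (real^'d \<Rightarrow> real)) set).
       ereal (\<integral>Z. excess_risk Q \<eta>Q (knn_classifier m \<beta> \<gamma> nP nQ Z) \<partial>data_measure m nP nQ P Q))
    \<le> ereal (K * effective_size CARD('d) m \<beta> \<gamma> nP nQ
                 powr (- (\<beta> * (1 + \<alpha>) / (2 * \<beta> + real CARD('d)))))"
proof -
  let ?class = "transfer_class m \<alpha> C\<^sub>\<alpha> \<beta> C\<^sub>\<beta> \<gamma> C \<mu>lo \<mu>hi c\<^sub>\<mu> r\<^sub>\<mu> ::
        ((nat \<Rightarrow> 'd pair measure) \<times> 'd pair measure \<times> (nat \<Rightarrow> real^'d \<Rightarrow> real) \<times> (real^'d \<Rightarrow> real)) set"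
  define rate where "rate = \<beta> * (1 + \<alpha>) / (2 * \<beta> + real CARD('d))"
  have rate: "0 \<le> rate" using assms(2,4) by (simp add: rate_def)
  have p: "0 < 2 + \<alpha>" using assms(2) by simp
  obtain K N0 where K: "1 \<le> K" and N0: "1 \<le> N0" and err:
    "\<And>nP nQ N P Q \<eta>P \<eta>Q x t. \<lbrakk>N = effective_size CARD('d) m \<beta> \<gamma> nP nQ; N0 \<le> N; (P, Q, \<eta>P, \<eta>Q) \<in> ?class;
        \<And>i. pair_distribution (P i); x \<in> msupp (marginal Q);
        \<bar>\<eta>Q x - 1/2\<bar> = t * knn_weight CARD('d) \<beta> N 1; 0 < t\<rbrakk> \<Longrightarrow>
      (\<integral>\<^sup>+Z. of_bool (knn_classifier m \<beta> \<gamma> nP nQ Z x \<noteq> bayes_classifier \<eta>Q x) \<partial>data_measure m nP nQ P Q)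
        \<le> ennreal (K * t powr (- (2 + \<alpha>)))"
    using pointwise_polynomial_error[where \<beta> = \<beta> and m = m and \<gamma> = \<gamma> and C = C and p = "2 + \<alpha>" and 'd = 'd
        and \<alpha> = \<alpha> and C\<^sub>\<alpha> = C\<^sub>\<alpha> and C\<^sub>\<beta> = C\<^sub>\<beta> and lo = \<mu>lo and hi = \<mu>hi and c\<^sub>\<mu> = c\<^sub>\<mu> and r\<^sub>\<mu> = r\<^sub>\<mu>,
        OF assms(1,4,6,9,11,12,7,8) p] by blast
  define K' where "K' = 2 powr (4 + \<alpha>) * K * C\<^sub>\<alpha> + N0 powr rate"
  have K': "0 < K'" using K N0 assms(3) by (auto simp: K'_def intro!: add_pos_nonneg)
  show ?thesis
  proof (intro exI[of _ K'] conjI allI impI K' SUP_least)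
    fix nP :: "nat \<Rightarrow> nat" and nQ :: nat and \<theta> :: "(nat \<Rightarrow> 'd pair measure) \<times> 'd pair measure \<times> (nat \<Rightarrow> real^'d \<Rightarrow> real) \<times> (real^'d \<Rightarrow> real)"
    assume pos: "0 < nQ \<or> (\<exists>i\<in>{1..m}. 0 < nP i)" and \<theta>: "\<theta> \<in> ?class"
    obtain P0 Q \<eta>P \<eta>Q where \<theta>_eq: "\<theta> = (P0, Q, \<eta>P, \<eta>Q)" by (cases \<theta>)
    \<comment> \<open>Source laws outside the index range are arbitrary; replacing them by Q makes every index a
      probability law and leaves the data distribution unchanged.\<close>
    define P where "P i = (if i \<in> {1..m} then P0 i else Q)" for i
    have cls: "(P, Q, \<eta>P, \<eta>Q) \<in> ?class"
      using \<theta> by (auto simp: \<theta>_eq transfer_class_def P_def)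
    have Q: "pair_distribution Q" "regression_function Q \<eta>Q" "margin_condition \<alpha> C\<^sub>\<alpha> Q \<eta>Q"
      and P: "pair_distribution (P i)" for i
      using \<theta> by (auto simp: \<theta>_eq transfer_class_def P_def)
    have D: "data_measure m nP nQ P0 Q = data_measure m nP nQ P Q"
      unfolding data_measure_def
      by (intro arg_cong2[where f = pair_measure] PiM_cong refl) (auto simp: P_def)
    define N where "N = effective_size CARD('d) m \<beta> \<gamma> nP nQ"
    have N1: "1 \<le> N"
      using pos
    proof
      assume "0 < nQ"
      moreover have "0 \<le> (\<Sum>i=1..m. real (nP i) powr ((2 * \<beta> + real CARD('d)) / (2 * \<gamma> i * \<beta> + real CARD('d))))"
        by (intro sum_nonneg) auto
      ultimately show ?thesis by (simp add: N_def effective_size_def)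
    next
      assume "\<exists>i\<in>{1..m}. 0 < nP i"
      then obtain i where i: "i \<in> {1..m}" "0 < nP i" by blast
      have "1 \<le> real (nP i) powr ((2 * \<beta> + real CARD('d)) / (2 * \<gamma> i * \<beta> + real CARD('d)))"
        using i assms(4) assms(7)[OF i(1)] by (intro ge_one_powr_ge_zero) auto
      also have "\<dots> \<le> (\<Sum>i=1..m. real (nP i) powr ((2 * \<beta> + real CARD('d)) / (2 * \<gamma> i * \<beta> + real CARD('d))))"
        using i by (intro member_le_sum) auto
      finally show ?thesis by (simp add: N_def effective_size_def)
    qed
    define \<tau> where "\<tau> = knn_weight CARD('d) \<beta> N 1"
    have \<tau>: "0 < \<tau>" using N1 by (simp add: \<tau>_def knn_weight_def)
    let ?E = "\<integral>Z. excess_risk Q \<eta>Q (knn_classifier m \<beta> \<gamma> nP nQ Z) \<partial>data_measure m nP nQ P Q"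
    have "?E \<le> K' * N powr (- rate)"
    proof (cases "N0 \<le> N")
      case True
      have "?E \<le> 2 powr (4 + \<alpha>) * K * C\<^sub>\<alpha> * \<tau> powr (1 + \<alpha>)"
      proof (rule expected_excess_risk_le[OF P Q(1,2) _ Q(3) _ assms(2) \<tau> K])
        fix x assume "x \<in> msupp (marginal Q)" "\<eta>Q x \<noteq> 1/2"
        then show "(\<integral>\<^sup>+Z. of_bool (knn_classifier m \<beta> \<gamma> nP nQ Z x \<noteq> bayes_classifier \<eta>Q x) \<partial>data_measure m nP nQ P Q)
            \<le> ennreal (K * (\<bar>\<eta>Q x - 1/2\<bar> / \<tau>) powr (- (2 + \<alpha>)))"
          using \<tau> by (intro err[OF N_def True cls P]) (auto simp: \<tau>_def)
      qed (use N1 assms(3) in \<open>auto simp: N_def\<close>)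
      also have "\<tau> powr (1 + \<alpha>) = N powr (- rate)"
        by (simp add: \<tau>_def knn_weight_def powr_powr rate_def)
      also have "2 powr (4 + \<alpha>) * K * C\<^sub>\<alpha> * N powr (- rate) \<le> K' * N powr (- rate)"
        by (intro mult_right_mono) (auto simp: K'_def)
      finally show ?thesis .
    next
      case False
      have "?E \<le> 1"
        by (rule expected_excess_risk_le_1[OF P Q(1,2)]) (use N1 in \<open>simp add: N_def\<close>)
      also have "1 = N powr rate * N powr (- rate)" using N1 by (simp add: powr_minus)
      also have "\<dots> \<le> N0 powr rate * N powr (- rate)"
        using False N1 rate by (intro mult_right_mono powr_mono2) auto
      also have "\<dots> \<le> K' * N powr (- rate)"
        using K assms(3) by (intro mult_right_mono) (auto simp: K'_def)
      finally show ?thesis .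
    qed
    then show "(case \<theta> of (P, Q, \<eta>P, \<eta>Q) \<Rightarrow>
        ereal (\<integral>Z. excess_risk Q \<eta>Q (knn_classifier m \<beta> \<gamma> nP nQ Z) \<partial>data_measure m nP nQ P Q))
        \<le> ereal (K' * effective_size CARD('d) m \<beta> \<gamma> nP nQ powr (- (\<beta> * (1 + \<alpha>) / (2 * \<beta> + real CARD('d)))))"
      by (simp add: \<theta>_eq D N_def rate_def)
  qed
qed

end
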